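(* Let $n \geq 2$ and let $G_1,\ldots,G_n$ be vertex-disjoint graphs, each of which is either a chordal graph or a cycle. Let $G$ be any vertex-gluing of $G_1,\ldots,G_n$ (obtained from their disjoint union by choosing $u_i \in V(G_i)$ for each $i$ and identifying $u_1,\ldots,u_n$ as a single vertex). Then for every $m \in \mathbb{N}$, \[ P_{DP}(G,m) = \frac{\prod_{i=1}^{n} P_{DP}(G_i,m)}{m^{n-1}}. \]
   Context: All graphs are finite and simple. A cover of a graph $G$ is a pair $\mathcal{H}=(L,H)$ where $H$ is a graph and $L: V(G) \to \mathcal{P}(V(H))$ satisfies: (1) $\{L(u): u \in V(G)\}$ is a partition of $V(H)$ into $|V(G)|$ parts; (2) $H[L(u)]$ is complete for each $u$; (3) if there is an edge of $H$ between $L(u)$ and $L(v)$ with $u \neq v$, then $uv \in E(G)$; (4) if $uv \in E(G)$, the edges of $H$ between $L(u)$ and $L(v)$ form a (possibly empty) matching. The cover is $m$-fold if $|L(u)|=m$ for all $u$. An $\mathcal{H}$-coloring of $G$ is an independent set of $H$ of size $|V(G)|$. $P_{DP}(G,m)$ is the minimum number of $\mathcal{H}$-colorings of $G$ over all $m$-fold covers $\mathcal{H}$ of $G$. *)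

theory Defs
  imports Complex_Main "HOL-Library.Disjoint_Sets" "HOL-Library.Ramsey"
begin

record 'a ugraph =
  verts :: "'a set"
  edges :: "'a set set"

definition simple_graph :: "'a ugraph \<Rightarrow> bool" where
  "simple_graph G \<longleftrightarrow> finite (verts G) \<and> edges G \<subseteq> [verts G]\<^bsup>2\<^esup>"

definition map_graph :: "('a \<Rightarrow> 'b) \<Rightarrow> 'a ugraph \<Rightarrow> 'b ugraph" where
  "map_graph f G = \<lparr>verts = f ` verts G, edges = (`) f ` edges G\<rparr>"

(* The edges of the closed walk xs!0, xs!1, ..., xs!(length xs - 1), xs!0. *)
definition cycle_edges :: "'a list \<Rightarrow> 'a set set" where
  "cycle_edges xs = {{xs ! i, xs ! (Suc i mod length xs)} | i. i < length xs}"

definition cycle_in :: "'a list \<Rightarrow> 'a ugraph \<Rightarrow> bool" where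
  "cycle_in xs G \<longleftrightarrow>
     3 \<le> length xs \<and> distinct xs \<and> set xs \<subseteq> verts G \<and> cycle_edges xs \<subseteq> edges G"

definition cycle_graph :: "'a ugraph \<Rightarrow> bool" where
  "cycle_graph G \<longleftrightarrow>
     (\<exists>xs. 3 \<le> length xs \<and> distinct xs \<and> verts G = set xs \<and> edges G = cycle_edges xs)"

definition chordal :: "'a ugraph \<Rightarrow> bool" where
  "chordal G \<longleftrightarrow>
     (\<forall>xs. cycle_in xs G \<and> 4 \<le> length xs \<longrightarrow>
        (\<exists>e\<in>edges G. e \<subseteq> set xs \<and> e \<notin> cycle_edges xs))"

definition disjoint_union :: "'i set \<Rightarrow> ('i \<Rightarrow> 'a ugraph) \<Rightarrow> 'a ugraph" where
  "disjoint_union I Gs = \<lparr>verts = (\<Union>i\<in>I. verts (Gs i)), edges = (\<Union>i\<in>I. edges (Gs i))\<rparr>"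

(* f is the quotient map of the identification; its target type is arbitrary, so that every
   isomorphic copy of the quotient graph counts as a gluing. *)
definition vertex_gluing :: "'i set \<Rightarrow> ('i \<Rightarrow> 'a ugraph) \<Rightarrow> 'b ugraph \<Rightarrow> bool" where
  "vertex_gluing I Gs G \<longleftrightarrow>
     (\<exists>u f. (\<forall>i\<in>I. u i \<in> verts (Gs i)) \<and>
        (\<forall>x\<in>verts (disjoint_union I Gs). \<forall>y\<in>verts (disjoint_union I Gs).
            f x = f y \<longleftrightarrow> x = y \<or> (x \<in> u ` I \<and> y \<in> u ` I)) \<and>
        G = map_graph f (disjoint_union I Gs))"

definition edges_between :: "'a ugraph \<Rightarrow> 'a set \<Rightarrow> 'a set \<Rightarrow> 'a set set" where
  "edges_between H A B = {e \<in> edges H. \<exists>x\<in>A. \<exists>y\<in>B. e = {x, y}}"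

definition matching :: "'a set set \<Rightarrow> bool" where
  "matching M \<longleftrightarrow> (\<forall>e\<in>M. \<forall>e'\<in>M. e \<noteq> e' \<longrightarrow> e \<inter> e' = {})"

definition dp_cover :: "'a ugraph \<Rightarrow> ('a \<Rightarrow> 'b set) \<Rightarrow> 'b ugraph \<Rightarrow> bool" where
  "dp_cover G L H \<longleftrightarrow>
     simple_graph H \<and>
     partition_on (verts H) (L ` verts G) \<and> card (L ` verts G) = card (verts G) \<and>
     (\<forall>u\<in>verts G. clique (L u) (edges H)) \<and>
     (\<forall>u\<in>verts G. \<forall>v\<in>verts G.
        u \<noteq> v \<and> edges_between H (L u) (L v) \<noteq> {} \<longrightarrow> {u, v} \<in> edges G) \<and>
     (\<forall>u\<in>verts G. \<forall>v\<in>verts G.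
        {u, v} \<in> edges G \<longrightarrow> matching (edges_between H (L u) (L v)))"

definition fold_cover :: "nat \<Rightarrow> 'a ugraph \<Rightarrow> ('a \<Rightarrow> 'b set) \<Rightarrow> 'b ugraph \<Rightarrow> bool" where
  "fold_cover m G L H \<longleftrightarrow> dp_cover G L H \<and> (\<forall>u\<in>verts G. card (L u) = m)"

definition cover_colorings :: "'a ugraph \<Rightarrow> 'b ugraph \<Rightarrow> 'b set set" where
  "cover_colorings G H = {S. S \<subseteq> verts H \<and> indep S (edges H) \<and> card S = card (verts G)}"

(* Cover graphs are finite, so it is enough to let them range over graphs on natural numbers;
   P_DP_le and P_DP_attained below show that no generality is lost. *)
definition P_DP :: "'a ugraph \<Rightarrow> nat \<Rightarrow> nat" where
  "P_DP G m = (LEAST k. \<exists>(L :: 'a \<Rightarrow> nat set) H.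
                 fold_cover m G L H \<and> k = card (cover_colorings G H))"

lemma edges_between_map_graph:
  assumes "simple_graph H" "inj_on f (verts H)" "A \<subseteq> verts H" "B \<subseteq> verts H"
  shows "edges_between (map_graph f H) (f ` A) (f ` B) = (`) f ` edges_between H A B"
proof (intro equalityI subsetI)
  fix e assume "e \<in> edges_between (map_graph f H) (f ` A) (f ` B)"
  then obtain d x y where d: "d \<in> edges H" "e = f ` d" "x \<in> A" "y \<in> B" "f ` d = f ` {x, y}"
    by (auto simp: edges_between_def map_graph_def)
  have "d \<subseteq> verts H" using d(1) assms(1) by (auto simp: simple_graph_def nsets_def)
  moreover have "{x, y} \<subseteq> verts H" using d assms by auto
  ultimately have "d = {x, y}" using d(5) assms(2) inj_on_image_eq_iff by metis
  then have "d \<in> edges_between H A B" using d by (auto simp: edges_between_def)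
  then show "e \<in> (`) f ` edges_between H A B" using d(2) by blast
next
  fix e assume "e \<in> (`) f ` edges_between H A B"
  then show "e \<in> edges_between (map_graph f H) (f ` A) (f ` B)"
    by (fastforce simp: edges_between_def map_graph_def)
qed

lemma edge_map_graph_iff:
  assumes "simple_graph H" "inj_on f (verts H)" "x \<in> verts H" "y \<in> verts H"
  shows "{f x, f y} \<in> edges (map_graph f H) \<longleftrightarrow> {x, y} \<in> edges H"
proof
  assume "{f x, f y} \<in> edges (map_graph f H)"
  then obtain d where d: "d \<in> edges H" "f ` d = f ` {x, y}" by (auto simp: map_graph_def)
  have "d \<subseteq> verts H" using d(1) assms(1) by (auto simp: simple_graph_def nsets_def)
  moreover have "{x, y} \<subseteq> verts H" using assms by auto
  ultimately have "d = {x, y}" using d(2) assms(2) inj_on_image_eq_iff by metis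
  then show "{x, y} \<in> edges H" using d by simp
next
  assume "{x, y} \<in> edges H"
  then have "f ` {x, y} \<in> edges (map_graph f H)" unfolding map_graph_def ugraph.simps by (rule imageI)
  then show "{f x, f y} \<in> edges (map_graph f H)" by simp
qed

lemma fold_cover_map_graph:
  assumes c: "fold_cover m G L H" and inj: "inj_on f (verts H)"
  shows "fold_cover m G (\<lambda>u. f ` L u) (map_graph f H)"
    and "card (cover_colorings G (map_graph f H)) = card (cover_colorings G H)"
proof -
  have s: "simple_graph H" using c by (simp add: fold_cover_def dp_cover_def)
  have p: "partition_on (verts H) (L ` verts G)"
    using c by (simp add: fold_cover_def dp_cover_def)
  have sub: "L u \<subseteq> verts H" if "u \<in> verts G" for u
    using p that by (auto simp: partition_on_def)
  have eq: "(\<lambda>u. f ` L u) ` verts G = (`) f ` (L ` verts G)" by auto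
  have injS: "inj_on ((`) f) (Pow (verts H))"
    using inj by (rule inj_on_image_Pow)
  have "simple_graph (map_graph f H)"
    unfolding simple_graph_def
  proof (intro conjI subsetI)
    show "finite (verts (map_graph f H))"
      using s by (simp add: simple_graph_def map_graph_def)
    fix e assume "e \<in> edges (map_graph f H)"
    then obtain d where d: "d \<in> edges H" "e = f ` d" by (auto simp: map_graph_def)
    then have "d \<subseteq> verts H" "finite d" "card d = 2"
      using s by (auto simp: simple_graph_def nsets_def)
    moreover from this have "card (f ` d) = 2"
      using inj by (metis card_image inj_on_subset)
    ultimately show "e \<in> [verts (map_graph f H)]\<^bsup>2\<^esup>"
      using d by (auto simp: nsets_def map_graph_def)
  qed
  moreover have "partition_on (verts (map_graph f H)) ((`) f ` (L ` verts G))"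
  proof (rule partition_onI)
    show "\<Union> ((`) f ` (L ` verts G)) = verts (map_graph f H)"
      using partition_onD1[OF p] by (simp add: map_graph_def image_UN)
    show "{} \<notin> (`) f ` (L ` verts G)"
      using p by (auto simp: partition_on_def)
    show "disjnt P Q" if PQ: "P \<in> (`) f ` (L ` verts G)" "Q \<in> (`) f ` (L ` verts G)" "P \<noteq> Q" for P Q
    proof -
      obtain u v where uv: "u \<in> verts G" "v \<in> verts G" "P = f ` L u" "Q = f ` L v"
        using PQ by auto
      then have "L u \<inter> L v = {}"
        using p PQ(3) by (metis disjointD imageI partition_on_def)
      then show ?thesis
        using uv sub inj by (metis disjnt_def image_empty inj_on_image_Int)
    qed
  qed
  moreover have "card ((`) f ` (L ` verts G)) = card (verts G)"
  proof -
    have "inj_on ((`) f) (L ` verts G)"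
      using injS by (rule inj_on_subset) (use sub in auto)
    then show ?thesis using c by (simp add: card_image fold_cover_def dp_cover_def)
  qed
  moreover have "clique (f ` L u) (edges (map_graph f H))" if "u \<in> verts G" for u
  proof -
    have k: "clique (L u) (edges H)" using c that by (simp add: fold_cover_def dp_cover_def)
    show ?thesis unfolding clique_def
    proof (intro ballI impI)
      fix v w assume vw: "v \<in> f ` L u" "w \<in> f ` L u" "v \<noteq> w"
      then obtain x y where xy: "x \<in> L u" "y \<in> L u" "v = f x" "w = f y" by auto
      then have "{x, y} \<in> edges H" using k vw(3) by (auto simp: clique_def)
      then show "{v, w} \<in> edges (map_graph f H)"
        using edge_map_graph_iff[OF s inj] sub[OF that] xy by blast
    qed
  qed
  moreover have eb: "edges_between (map_graph f H) (f ` L u) (f ` L v) =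
      (`) f ` edges_between H (L u) (L v)" if "u \<in> verts G" "v \<in> verts G" for u v
    using edges_between_map_graph[OF s inj sub sub] that by blast
  moreover have "matching ((`) f ` edges_between H (L u) (L v))"
    if "u \<in> verts G" "v \<in> verts G" "{u, v} \<in> edges G" for u v
  proof -
    have M: "matching (edges_between H (L u) (L v))"
      using c that by (simp add: fold_cover_def dp_cover_def)
    have sv: "e \<subseteq> verts H" if "e \<in> edges_between H (L u) (L v)" for e
      using s that by (auto simp: edges_between_def simple_graph_def nsets_def)
    show ?thesis unfolding matching_def
    proof (intro ballI impI)
      fix e e' assume e: "e \<in> (`) f ` edges_between H (L u) (L v)"
        "e' \<in> (`) f ` edges_between H (L u) (L v)" "e \<noteq> e'"
      then obtain d d' where d: "d \<in> edges_between H (L u) (L v)"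
        "d' \<in> edges_between H (L u) (L v)" "e = f ` d" "e' = f ` d'" by auto
      then have "d \<inter> d' = {}" using M e(3) by (auto simp: matching_def)
      then show "e \<inter> e' = {}"
        using inj_on_image_Int[OF inj sv[OF d(1)] sv[OF d(2)]] d by simp
    qed
  qed
  moreover have "card (f ` L u) = m" if "u \<in> verts G" for u
    using c that sub[OF that] inj by (metis card_image fold_cover_def inj_on_subset)
  ultimately show "fold_cover m G (\<lambda>u. f ` L u) (map_graph f H)"
    using c unfolding fold_cover_def dp_cover_def eq by simp
  have ind: "indep (f ` S) (edges (map_graph f H)) \<longleftrightarrow> indep S (edges H)"
    if "S \<subseteq> verts H" for S
  proof -
    have "{f x, f y} \<in> edges (map_graph f H) \<longleftrightarrow> {x, y} \<in> edges H" "f x = f y \<longleftrightarrow> x = y"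
      if "x \<in> S" "y \<in> S" for x y
      using edge_map_graph_iff[OF s inj] inj that \<open>S \<subseteq> verts H\<close>
      by (auto dest: inj_onD)
    then show ?thesis by (simp add: indep_def)
  qed
  have "cover_colorings G (map_graph f H) = (`) f ` cover_colorings G H"
  proof (intro equalityI subsetI)
    fix T assume T: "T \<in> cover_colorings G (map_graph f H)"
    then obtain S where S: "S \<subseteq> verts H" "T = f ` S"
      by (auto simp: cover_colorings_def map_graph_def subset_image_iff)
    then have "S \<in> cover_colorings G H"
      using T ind[OF S(1)] card_image[OF inj_on_subset[OF inj S(1)]]
      by (simp add: cover_colorings_def)
    then show "T \<in> (`) f ` cover_colorings G H" using S by auto
  next
    fix T assume "T \<in> (`) f ` cover_colorings G H"
    then obtain S where S: "S \<in> cover_colorings G H" "T = f ` S" by auto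
    then have sv: "S \<subseteq> verts H" by (simp add: cover_colorings_def)
    then have "T \<subseteq> verts (map_graph f H)" using S by (auto simp: map_graph_def)
    then show "T \<in> cover_colorings G (map_graph f H)"
      using S ind[OF sv] card_image[OF inj_on_subset[OF inj sv]]
      by (simp add: cover_colorings_def)
  qed
  moreover have "inj_on ((`) f) (cover_colorings G H)"
    using injS by (rule inj_on_subset) (auto simp: cover_colorings_def)
  ultimately show "card (cover_colorings G (map_graph f H)) = card (cover_colorings G H)"
    by (simp add: card_image)
qed

lemma fold_cover_nat:
  fixes L :: "'a \<Rightarrow> 'b set"
  assumes "fold_cover m G L H"
  obtains L' :: "'a \<Rightarrow> nat set" and H'
    where "fold_cover m G L' H'" "card (cover_colorings G H') = card (cover_colorings G H)"
proof -
  have "finite (verts H)"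
    using assms by (simp add: fold_cover_def dp_cover_def simple_graph_def)
  then obtain f :: "'b \<Rightarrow> nat" where "inj_on f (verts H)"
    using finite_imp_inj_to_nat_seg[of "verts H"] by auto
  from fold_cover_map_graph[OF assms this] show thesis by (rule that)
qed

lemma P_DP_le:
  assumes "fold_cover m G L H"
  shows "P_DP G m \<le> card (cover_colorings G H)"
proof -
  obtain L' :: "'a \<Rightarrow> nat set" and H'
    where "fold_cover m G L' H'" "card (cover_colorings G H') = card (cover_colorings G H)"
    using fold_cover_nat[OF assms] .
  then show ?thesis unfolding P_DP_def by (intro Least_le) (metis (no_types))
qed

lemma fold_cover_exists:
  assumes "simple_graph G" "1 \<le> m"
  shows "\<exists>L H. fold_cover m G (L :: 'a \<Rightarrow> ('a \<times> nat) set) H"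
proof -
  define L where "L = (\<lambda>u::'a. {u} \<times> {..<m})"
  define H where "H = \<lparr>verts = verts G \<times> {..<m}, edges = (\<Union>u\<in>verts G. [L u]\<^bsup>2\<^esup>)\<rparr>"
  have ne: "L u \<noteq> {}" for u using assms(2) by (auto simp: L_def lessThan_empty_iff)
  have dj: "L u \<inter> L v = {}" if "u \<noteq> v" for u v using that by (auto simp: L_def)
  have "inj L" using ne dj by (metis Int_absorb injI)
  then have "card (L ` verts G) = card (verts G)"
    by (intro card_image) (rule inj_on_subset, auto)
  moreover have "simple_graph H"
    using assms(1) by (auto simp: simple_graph_def H_def L_def nsets_def)
  moreover have "partition_on (verts H) (L ` verts G)"
  proof (rule partition_onI)
    show "\<Union> (L ` verts G) = verts H" by (auto simp: L_def H_def)
    show "{} \<notin> L ` verts G" using ne by auto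
    show "disjnt P Q" if "P \<in> L ` verts G" "Q \<in> L ` verts G" "P \<noteq> Q" for P Q
      using that dj unfolding disjnt_def by (metis imageE)
  qed
  moreover have "clique (L u) (edges H)" if "u \<in> verts G" for u
    using that by (auto simp: clique_def H_def)
  moreover have "edges_between H (L u) (L v) = {}" if "u \<noteq> v" for u v
    using that by (auto simp: edges_between_def H_def L_def)
  moreover have "u \<noteq> v" if "{u, v} \<in> edges G" for u v
    using that assms(1) by (auto simp: simple_graph_def nsets_def)
  moreover have "card (L u) = m" for u by (simp add: L_def)
  ultimately have "fold_cover m G L H"
    by (auto simp: fold_cover_def dp_cover_def matching_def)
  then show ?thesis by blast
qed

lemma P_DP_attained:
  assumes "simple_graph G" "1 \<le> m"
  shows "\<exists>(L :: 'a \<Rightarrow> nat set) H. fold_cover m G L H \<and> P_DP G m = card (cover_colorings G H)"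
proof -
  obtain L0 :: "'a \<Rightarrow> ('a \<times> nat) set" and H0 where "fold_cover m G L0 H0"
    using fold_cover_exists[OF assms] by blast
  from fold_cover_nat[OF this]
  have "\<exists>k (L :: 'a \<Rightarrow> nat set) H. fold_cover m G L H \<and> k = card (cover_colorings G H)"
    by metis
  then show ?thesis unfolding P_DP_def by (rule LeastI_ex)
qed

end

theory Submission
  imports Defs
begin

text \<open>
  After labelling every list of an \<open>m\<close>-fold cover by the colours \<open>0, \<dots>, m - 1\<close>, a cover becomes a
  conflict relation that is a partial matching on every edge. Fixing the colour \<open>x\<close> of the glued vertex
  \<open>w\<close> makes the parts independent, so the number of colourings is the sum over \<open>x\<close> of the products of
  the rooted counts of the parts. The formula therefore follows once every part \<open>G\<close> is balanced at
  \<open>w\<close>: in every cover each colour of \<open>w\<close> extends to at least \<open>P_DP G m / m\<close> colourings. In a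
  cover that attains the minimum, all rooted counts are then equal to \<open>P_DP G m / m\<close>.

  For chordal \<open>G\<close>, Dirac's theorem gives a simplicial vertex \<open>s \<noteq> w\<close>; if \<open>s\<close> has degree \<open>d\<close>,
  a colouring of \<open>G - s\<close> has at least \<open>m - d\<close> extensions in any cover, and exactly that many for
  ordinary proper colourings. For a cycle of length \<open>n\<close>, opened at \<open>w\<close>, a rooted count is at least
  the smaller of the numbers of closed and of non-closed walks of length \<open>n\<close> between two fixed vertices
  of the complete graph on \<open>m\<close> vertices. Both numbers are realised by covers, the first by the
  untwisted one and the second by a cover whose matchings compose to a cyclic shift.
\<close>

subsection \<open>Covers as conflict relations\<close>

text \<open>\<open>K u i v j\<close> means that colour \<open>i\<close> of \<open>u\<close> is joined to colour \<open>j\<close> of \<open>v\<close>; only its values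
  on edges \<open>{u, v}\<close> and colours below \<open>m\<close> matter.\<close>

definition conflict_relation :: "'a ugraph \<Rightarrow> nat \<Rightarrow> ('a \<Rightarrow> nat \<Rightarrow> 'a \<Rightarrow> nat \<Rightarrow> bool) \<Rightarrow> bool" where
  "conflict_relation G m K \<longleftrightarrow>
     (\<forall>u v i j. {u, v} \<in> edges G \<and> i < m \<and> j < m \<and> K u i v j \<longrightarrow>
        K v j u i \<and> (\<forall>j'<m. K u i v j' \<longrightarrow> j' = j))"

text \<open>Colourings are extensional functions, so that different colourings differ at a vertex of
  \<open>G\<close> and a finite graph has finitely many. Since \<open>{u, v}\<close> is unordered,
  conflicts are excluded in both orientations of an edge even if \<open>K\<close> is not
  symmetric.\<close>

definition dp_colorings ::
  "'a ugraph \<Rightarrow> nat \<Rightarrow> ('a \<Rightarrow> nat \<Rightarrow> 'a \<Rightarrow> nat \<Rightarrow> bool) \<Rightarrow> ('a \<Rightarrow> nat) set" where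
  "dp_colorings G m K =
     {c \<in> verts G \<rightarrow>\<^sub>E {..<m}. \<forall>u v. {u, v} \<in> edges G \<longrightarrow> \<not> K u (c u) v (c v)}"

lemma simple_graph_edgeD:
  assumes "simple_graph G" "{u, v} \<in> edges G"
  shows "u \<in> verts G" "v \<in> verts G" "u \<noteq> v"
  using assms by (auto simp: simple_graph_def nsets_def)

lemma simple_graph_edgeE:
  assumes "simple_graph G" "e \<in> edges G"
  obtains u v where "e = {u, v}" "u \<in> verts G" "v \<in> verts G" "u \<noteq> v"
proof -
  have e: "e \<subseteq> verts G" "card e = 2" using assms by (auto simp: simple_graph_def nsets_def)
  then obtain u v where "e = {u, v}" "u \<noteq> v" by (auto simp: card_2_iff)
  then show thesis using e that by auto
qed

lemma finite_dp_colorings: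
  assumes "simple_graph G"
  shows "finite (dp_colorings G m K)"
  using assms unfolding dp_colorings_def simple_graph_def
  by (intro finite_Collect_conjI disjI1) (simp add: finite_PiE)

lemma dp_colorings_lt:
  assumes "c \<in> dp_colorings G m K" "u \<in> verts G"
  shows "c u < m"
  using assms by (auto simp: dp_colorings_def)

lemma dp_colorings_cong:
  assumes "simple_graph G"
    and "\<And>u v i j. {u, v} \<in> edges G \<Longrightarrow> i < m \<Longrightarrow> j < m \<Longrightarrow> K u i v j \<longleftrightarrow> K' u i v j"
  shows "dp_colorings G m K = dp_colorings G m K'"
proof -
  have "K u (c u) v (c v) \<longleftrightarrow> K' u (c u) v (c v)"
    if "c \<in> verts G \<rightarrow>\<^sub>E {..<m}" "{u, v} \<in> edges G" for c u v
    using assms(2)[OF that(2)] simple_graph_edgeD(1,2)[OF assms(1) that(2)] that(1)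
    by (meson PiE_mem lessThan_iff)
  then show ?thesis unfolding dp_colorings_def by blast
qed

text \<open>The cardinality clause of \<open>dp_cover\<close> makes \<open>L\<close> injective on
  the vertices, so different vertices own different blocks of the partition.\<close>

lemma dp_cover_disjoint:
  assumes "simple_graph G" "dp_cover G L H" "u \<in> verts G" "v \<in> verts G" "u \<noteq> v"
  shows "L u \<inter> L v = {}"
proof -
  have "inj_on L (verts G)"
    using assms(1,2) by (auto simp: dp_cover_def simple_graph_def intro: eq_card_imp_inj_on)
  then have "L u \<noteq> L v" using assms(3-5) by (auto dest: inj_onD)
  then show ?thesis
    using assms(2-4) by (auto simp: dp_cover_def partition_on_def disjoint_def)
qed

text \<open>Each list is a clique, so an independent set meets it at most once; with
  \<open>card (verts G)\<close> elements it meets every list exactly once and amounts to a choice of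
  one colour per vertex.\<close>

lemma card_cover_colorings:
  assumes G: "simple_graph G" and cov: "fold_cover m G L H"
    and \<phi>: "\<And>u. u \<in> verts G \<Longrightarrow> bij_betw (\<phi> u) {..<m} (L u)"
  shows "card (cover_colorings G H) =
    card (dp_colorings G m (\<lambda>u i v j. {\<phi> u i, \<phi> v j} \<in> edges H))"
    (is "_ = card ?C")
proof -
  define h where "h c = (\<lambda>u. \<phi> u (c u)) ` verts G" for c :: "'a \<Rightarrow> nat"
  have fin: "finite (verts G)" using G by (simp add: simple_graph_def)
  have d: "dp_cover G L H" using cov by (simp add: fold_cover_def)
  have disj: "u = v" if "u \<in> verts G" "v \<in> verts G" "x \<in> L u" "x \<in> L v" for u v x
    using dp_cover_disjoint[OF G d] that by blast
  have vH: "verts H = (\<Union>u\<in>verts G. L u)"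
    using d by (auto simp: dp_cover_def partition_on_def)
  have \<phi>L: "\<phi> u i \<in> L u" if "u \<in> verts G" "i < m" for u i
    using \<phi>[OF that(1)] that(2) by (auto simp: bij_betw_def)
  have \<phi>inj: "i = j" if "u \<in> verts G" "i < m" "j < m" "\<phi> u i = \<phi> u j" for u i j
    using \<phi>[OF that(1)] that by (auto simp: bij_betw_def dest: inj_onD)
  have inj: "inj_on (\<lambda>u. \<phi> u (c u)) (verts G)" if "c \<in> verts G \<rightarrow>\<^sub>E {..<m}" for c
    using that \<phi>L disj by (intro inj_onI) (metis PiE_mem lessThan_iff)
  have "bij_betw h ?C (cover_colorings G H)"
    unfolding bij_betw_def
  proof (intro conjI equalityI subsetI inj_onI)
    fix c c' assume c: "c \<in> ?C" "c' \<in> ?C" and hh: "h c = h c'"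
    have "c u = c' u" if u: "u \<in> verts G" for u
    proof -
      have "\<phi> u (c u) \<in> h c'" using hh u by (auto simp: h_def)
      then obtain v where v: "v \<in> verts G" "\<phi> u (c u) = \<phi> v (c' v)" by (auto simp: h_def)
      moreover have "v = u"
        using disj[OF v(1) u] \<phi>L[OF u dp_colorings_lt[OF c(1) u]] v
          \<phi>L[OF v(1) dp_colorings_lt[OF c(2) v(1)]] by simp
      ultimately show ?thesis
        using \<phi>inj[OF u dp_colorings_lt[OF c(1) u] dp_colorings_lt[OF c(2) u]] by simp
    qed
    moreover have "c \<in> verts G \<rightarrow>\<^sub>E {..<m}" "c' \<in> verts G \<rightarrow>\<^sub>E {..<m}"
      using c by (simp_all add: dp_colorings_def)
    ultimately show "c = c'" by (metis PiE_ext)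
  next
    fix S assume "S \<in> h ` ?C"
    then obtain c where c: "c \<in> ?C" "S = h c" by auto
    have cE: "c \<in> verts G \<rightarrow>\<^sub>E {..<m}" using c by (simp add: dp_colorings_def)
    have lt: "c u < m" if "u \<in> verts G" for u using cE that by auto
    have "S \<subseteq> verts H" using c(2) lt \<phi>L by (auto simp: h_def vH)
    moreover have "card S = card (verts G)" using c(2) card_image[OF inj[OF cE]] by (simp add: h_def)
    moreover have "indep S (edges H)" unfolding indep_def
    proof (intro ballI impI notI)
      fix x y assume xy: "x \<in> S" "y \<in> S" "x \<noteq> y" "{x, y} \<in> edges H"
      then obtain u v where uv: "u \<in> verts G" "v \<in> verts G" "x = \<phi> u (c u)" "y = \<phi> v (c v)"
        using c(2) by (auto simp: h_def)
      have "u \<noteq> v" using xy uv by auto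
      \<comment> \<open>Different lists are joined only over edges of \<open>G\<close>, so absence
        of conflicts along \<open>edges G\<close> gives independence.\<close>
      moreover have "{x, y} \<in> edges_between H (L u) (L v)"
        unfolding edges_between_def mem_Collect_eq using uv xy(4) \<phi>L lt by blast
      ultimately have "{u, v} \<in> edges G" using d uv by (auto simp: dp_cover_def)
      then show False using c(1) uv xy(4) by (auto simp: dp_colorings_def)
    qed
    ultimately show "S \<in> cover_colorings G H" by (simp add: cover_colorings_def)
  next
    fix S assume S: "S \<in> cover_colorings G H"
    then have SH: "S \<subseteq> verts H" and cardS: "card S = card (verts G)" and ind: "indep S (edges H)"
      by (auto simp: cover_colorings_def)
    have finS: "finite S" using SH d by (auto simp: dp_cover_def simple_graph_def intro: finite_subset)
    have "\<forall>s\<in>S. \<exists>u. u \<in> verts G \<and> s \<in> L u" using SH vH by auto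
    then obtain p where p: "\<And>s. s \<in> S \<Longrightarrow> p s \<in> verts G \<and> s \<in> L (p s)" by metis
    have "inj_on p S"
    proof (rule inj_onI, rule ccontr)
      fix s t assume st: "s \<in> S" "t \<in> S" "p s = p t" "s \<noteq> t"
      have "clique (L (p s)) (edges H)" using d p[OF st(1)] by (auto simp: dp_cover_def)
      then have "{s, t} \<in> edges H" using p[OF st(1)] p[OF st(2)] st by (auto simp: clique_def)
      then show False using ind st by (auto simp: indep_def)
    qed
    \<comment> \<open>An injection of \<open>S\<close> into a vertex set of the same size is
      onto.\<close>
    then have pS: "p ` S = verts G"
      using p cardS fin by (intro card_subset_eq) (auto simp: card_image)
    have "\<exists>i. i < m \<and> \<phi> u i \<in> S" if u: "u \<in> verts G" for u
    proof -
      have "u \<in> p ` S" using u pS by simp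
      then obtain s where s: "s \<in> S" "p s = u" by (elim imageE) simp
      then have "s \<in> \<phi> u ` {..<m}" using p[OF s(1)] \<phi>[OF u] by (simp add: bij_betw_def)
      then show ?thesis using s by auto
    qed
    then obtain c0 where c0: "\<And>u. u \<in> verts G \<Longrightarrow> c0 u < m \<and> \<phi> u (c0 u) \<in> S" by metis
    define c where "c = restrict c0 (verts G)"
    have cE: "c \<in> verts G \<rightarrow>\<^sub>E {..<m}" using c0 by (auto simp: c_def)
    have cS: "\<phi> u (c u) \<in> S" if "u \<in> verts G" for u using c0 that by (simp add: c_def)
    have "h c = S"
      using cS finS cardS card_image[OF inj[OF cE]]
      by (intro card_subset_eq) (auto simp: h_def)
    moreover have "c \<in> ?C" unfolding dp_colorings_def mem_Collect_eq
    proof (intro conjI allI impI cE notI)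
      fix u v assume uv: "{u, v} \<in> edges G" "{\<phi> u (c u), \<phi> v (c v)} \<in> edges H"
      note D = simple_graph_edgeD[OF G uv(1)]
      have "\<phi> u (c u) \<noteq> \<phi> v (c v)" using inj_onD[OF inj[OF cE]] D by blast
      then show False using ind uv(2) cS D by (auto simp: indep_def)
    qed
    ultimately show "S \<in> h ` ?C" by auto
  qed
  then show ?thesis by (simp add: bij_betw_same_card)
qed

text \<open>The lists of an optimal cover are numbered by arbitrary bijections
  \<open>\<phi> u\<close>; the matching condition then becomes uniqueness of the partner of a
  colour.\<close>

lemma P_DP_attained_conflict:
  assumes G: "simple_graph G" and "1 \<le> m"
  obtains K where "conflict_relation G m K" "P_DP G m = card (dp_colorings G m K)"
proof -
  obtain L :: "'a \<Rightarrow> nat set" and H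
    where cov: "fold_cover m G L H" and P: "P_DP G m = card (cover_colorings G H)"
    using P_DP_attained[OF assms] by blast
  have d: "dp_cover G L H" using cov by (simp add: fold_cover_def)
  have "\<exists>f. bij_betw f {..<m} (L u)" if "u \<in> verts G" for u
  proof -
    have "card (L u) = m" using cov that by (simp add: fold_cover_def)
    \<comment> \<open>Infinite sets have \<open>card\<close> 0, so a positive \<open>m\<close>
      forces a finite list.\<close>
    moreover have "finite (L u)" using calculation \<open>1 \<le> m\<close> by (intro card_ge_0_finite) simp
    ultimately show ?thesis using ex_bij_betw_nat_finite[of "L u"] by (auto simp: atLeast0LessThan)
  qed
  then obtain \<phi> where \<phi>: "\<And>u. u \<in> verts G \<Longrightarrow> bij_betw (\<phi> u) {..<m} (L u)" by metis
  let ?K = "\<lambda>u i v j. {\<phi> u i, \<phi> v j} \<in> edges H"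
  have "conflict_relation G m ?K"
    unfolding conflict_relation_def
  proof (intro allI impI conjI)
    fix u v i j assume a: "{u, v} \<in> edges G \<and> i < m \<and> j < m \<and> {\<phi> u i, \<phi> v j} \<in> edges H"
    then show "{\<phi> v j, \<phi> u i} \<in> edges H" by (simp add: insert_commute)
    fix j' assume j': "j' < m" "{\<phi> u i, \<phi> v j'} \<in> edges H"
    have uv: "u \<in> verts G" "v \<in> verts G" "u \<noteq> v" using simple_graph_edgeD[OF G] a by blast+
    have mem: "\<phi> u i \<in> L u" "\<phi> v j \<in> L v" "\<phi> v j' \<in> L v"
      using \<phi>[OF uv(1)] \<phi>[OF uv(2)] a j' by (auto simp: bij_betw_def)
    then have "{\<phi> u i, \<phi> v j} \<in> edges_between H (L u) (L v)"
      "{\<phi> u i, \<phi> v j'} \<in> edges_between H (L u) (L v)"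
      using a j' by (auto simp: edges_between_def)
    moreover have "matching (edges_between H (L u) (L v))"
      using d uv a by (auto simp: dp_cover_def)
    ultimately have "{\<phi> u i, \<phi> v j} = {\<phi> u i, \<phi> v j'}"
      unfolding matching_def by (metis disjoint_iff insertI1)
    \<comment> \<open>Lists of different vertices are disjoint, which rules out the crossed reading
      of the equality of the two pairs.\<close>
    moreover have "\<phi> u i \<noteq> \<phi> v j" "\<phi> u i \<noteq> \<phi> v j'" using dp_cover_disjoint[OF G d uv] mem by auto
    ultimately have "\<phi> v j' = \<phi> v j" by (metis doubleton_eq_iff)
    moreover have "inj_on (\<phi> v) {..<m}" using \<phi>[OF uv(2)] by (simp add: bij_betw_def)
    ultimately show "j' = j" using a j'(1) by (metis inj_onD lessThan_iff)
  qed
  moreover have "P_DP G m = card (dp_colorings G m ?K)"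
    unfolding P by (rule card_cover_colorings[OF G cov \<phi>])
  ultimately show thesis by (rule that)
qed

text \<open>Every conflict relation comes from a cover: take \<open>m\<close> private colours at
  each vertex, a clique on each list, and the conflicting pairs \<open>X\<close> as cross
  edges.\<close>

lemma P_DP_le_conflict:
  assumes G: "simple_graph G" and m: "1 \<le> m" and K: "conflict_relation G m K"
  shows "P_DP G m \<le> card (dp_colorings G m K)"
proof -
  define L where "L = (\<lambda>u::'a. {u} \<times> {..<m})"
  define X where "X = {{(u, i), (v, j)} | u i v j. {u, v} \<in> edges G \<and> i < m \<and> j < m \<and> K u i v j}"
  define H where "H = \<lparr>verts = verts G \<times> {..<m}, edges = (\<Union>u\<in>verts G. [L u]\<^bsup>2\<^esup>) \<union> X\<rparr>"
  have ne: "L u \<noteq> {}" for u using m by (auto simp: L_def lessThan_empty_iff)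
  have dj: "L u \<inter> L v = {}" if "u \<noteq> v" for u v using that by (auto simp: L_def)
  have "inj L" using ne dj by (metis Int_absorb injI)
  then have "card (L ` verts G) = card (verts G)"
    by (intro card_image) (rule inj_on_subset, auto)
  have HE: "{(u, i), (v, j)} \<in> edges H \<longleftrightarrow> {u, v} \<in> edges G \<and> i < m \<and> j < m \<and> K u i v j"
    if "u \<noteq> v" for u v i j
  proof -
    have "{(u, i), (v, j)} \<notin> [L w]\<^bsup>2\<^esup>" for w using that by (auto simp: L_def nsets_def)
    then have "{(u, i), (v, j)} \<in> edges H \<longleftrightarrow> {(u, i), (v, j)} \<in> X"
      unfolding H_def ugraph.simps by blast
    also have "\<dots> \<longleftrightarrow> {u, v} \<in> edges G \<and> i < m \<and> j < m \<and> K u i v j"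
    proof
      assume "{(u, i), (v, j)} \<in> X"
      then obtain u' i' v' j' where *: "{u', v'} \<in> edges G" "i' < m" "j' < m" "K u' i' v' j'"
        "{(u, i), (v, j)} = {(u', i'), (v', j')}" unfolding X_def by blast
      \<comment> \<open>The unordered pair may present the edge in the reverse orientation; symmetry
        of \<open>K\<close> on edges covers this case.\<close>
      then have "K v' j' u' i'" using K by (auto simp: conflict_relation_def)
      then show "{u, v} \<in> edges G \<and> i < m \<and> j < m \<and> K u i v j"
        using * by (auto simp: doubleton_eq_iff insert_commute)
    qed (auto simp: X_def)
    finally show ?thesis .
  qed
  have EB: "\<exists>i j. e = {(u, i), (v, j)} \<and> {u, v} \<in> edges G \<and> i < m \<and> j < m \<and> K u i v j"
    if "u \<noteq> v" "e \<in> edges_between H (L u) (L v)" for u v e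
    using that HE[OF that(1)] by (auto simp: edges_between_def L_def)
  have "simple_graph H"
    unfolding simple_graph_def
  proof (intro conjI subsetI)
    show "finite (verts H)" using G by (simp add: simple_graph_def H_def)
    fix e assume "e \<in> edges H"
    then consider u where "u \<in> verts G" "e \<in> [L u]\<^bsup>2\<^esup>" | "e \<in> X" by (auto simp: H_def)
    then show "e \<in> [verts H]\<^bsup>2\<^esup>"
    proof cases
      case 1 then show ?thesis by (auto simp: nsets_def L_def H_def)
    next
      case 2
      then obtain u i v j where e: "e = {(u, i), (v, j)}" "{u, v} \<in> edges G" "i < m" "j < m"
        by (auto simp: X_def)
      then show ?thesis using simple_graph_edgeD[OF G e(2)] by (auto simp: H_def nsets_def)
    qed
  qed
  moreover have "partition_on (verts H) (L ` verts G)"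
  proof (rule partition_onI)
    show "\<Union> (L ` verts G) = verts H" by (auto simp: L_def H_def)
    show "{} \<notin> L ` verts G" using ne by auto
    show "disjnt P Q" if "P \<in> L ` verts G" "Q \<in> L ` verts G" "P \<noteq> Q" for P Q
      using that dj unfolding disjnt_def by (metis imageE)
  qed
  moreover note \<open>card (L ` verts G) = card (verts G)\<close>
  moreover have "clique (L u) (edges H)" if "u \<in> verts G" for u
    using that by (auto simp: clique_def H_def)
  moreover have "matching (edges_between H (L u) (L v))" if uv: "{u, v} \<in> edges G" for u v
    unfolding matching_def
  proof (intro ballI impI)
    fix e e' assume e: "e \<in> edges_between H (L u) (L v)" "e' \<in> edges_between H (L u) (L v)" "e \<noteq> e'"
    have ne: "u \<noteq> v" using simple_graph_edgeD[OF G uv] by simp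
    obtain i j where ij: "e = {(u, i), (v, j)}" "i < m" "j < m" "K u i v j" using EB[OF ne e(1)] by blast
    obtain i' j' where ij': "e' = {(u, i'), (v, j')}" "i' < m" "j' < m" "K u i' v j'"
      using EB[OF ne e(2)] by blast
    have vu: "{v, u} \<in> edges G" using uv by (simp add: insert_commute)
    have "K v j u i" "K v j' u i'" using K uv ij ij' unfolding conflict_relation_def by blast+
    \<comment> \<open>Partners are unique from either end, so two cross edges that share an end
      coincide.\<close>
    then have "i = i' \<longleftrightarrow> j = j'"
      using K uv vu ij(2-4) ij'(2-4) unfolding conflict_relation_def by metis
    then show "e \<inter> e' = {}" using e(3) ij(1) ij'(1) ne by auto
  qed
  moreover have "{u, v} \<in> edges G" if "u \<noteq> v" "edges_between H (L u) (L v) \<noteq> {}" for u v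
    using that EB by blast
  ultimately have "dp_cover G L H"
    unfolding dp_cover_def by simp
  then have cov: "fold_cover m G L H" by (auto simp: fold_cover_def L_def)
  have "P_DP G m \<le> card (cover_colorings G H)" by (rule P_DP_le[OF cov])
  also have "\<dots> = card (dp_colorings G m (\<lambda>u i v j. {(u, i), (v, j)} \<in> edges H))"
    by (rule card_cover_colorings[OF G cov, of Pair]) (auto simp: L_def bij_betw_def inj_on_def)
  also have "dp_colorings G m (\<lambda>u i v j. {(u, i), (v, j)} \<in> edges H) = dp_colorings G m K"
    using HE simple_graph_edgeD(3)[OF G] by (intro dp_colorings_cong[OF G]) blast
  finally show ?thesis .
qed

subsection \<open>Balanced graphs and gluing\<close>

definition rooted_colorings where
  "rooted_colorings G m K v x = {c \<in> dp_colorings G m K. c v = x}"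

text \<open>In a cover attaining the minimum, \<open>P_DP G m / m\<close> is the average rooted
  count; this average has to bound every rooted count of every cover from below. The factor
  \<open>m\<close> on the right avoids the division.\<close>

definition balanced_at :: "'a ugraph \<Rightarrow> nat \<Rightarrow> 'a \<Rightarrow> bool" where
  "balanced_at G m v \<longleftrightarrow>
     (\<forall>K x. conflict_relation G m K \<and> x < m \<longrightarrow> P_DP G m \<le> m * card (rooted_colorings G m K v x))"

lemma card_dp_colorings_eq_sum:
  assumes "simple_graph G" "v \<in> verts G"
  shows "card (dp_colorings G m K) = (\<Sum>x<m. card (rooted_colorings G m K v x))"
proof -
  have "dp_colorings G m K = (\<Union>x<m. rooted_colorings G m K v x)"
    using assms(2) by (auto simp: rooted_colorings_def dest: dp_colorings_lt)
  moreover have "finite (rooted_colorings G m K v x)" for x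
    using finite_dp_colorings[OF assms(1)] by (simp add: rooted_colorings_def)
  moreover have "rooted_colorings G m K v x \<inter> rooted_colorings G m K v y = {}" if "x \<noteq> y" for x y
    using that by (auto simp: rooted_colorings_def)
  ultimately show ?thesis by (simp add: card_UN_disjoint)
qed

text \<open>The \<open>m\<close> rooted counts, each multiplied by \<open>m\<close>, are all at
  least \<open>P_DP G m\<close>, while in an optimal cover they sum to exactly
  \<open>m * P_DP G m\<close>. Hence each of them equals the bound.\<close>

lemma balanced_at_card:
  assumes "simple_graph G" "v \<in> verts G" "balanced_at G m v" "conflict_relation G m K" "x < m"
    and "P_DP G m = card (dp_colorings G m K)"
  shows "m * card (rooted_colorings G m K v x) = P_DP G m"
proof -
  have ge: "P_DP G m \<le> m * card (rooted_colorings G m K v y)" if "y < m" for y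
    using assms(3,4) that by (auto simp: balanced_at_def)
  have "(\<Sum>y<m. P_DP G m) = (\<Sum>y<m. m * card (rooted_colorings G m K v y))"
    using assms(6) card_dp_colorings_eq_sum[OF assms(1,2), of m K] by (simp add: sum_distrib_left)
  then show ?thesis
    using sum_mono_inv[of "\<lambda>_. P_DP G m" "{..<m}" "\<lambda>y. m * card (rooted_colorings G m K v y)" x]
      ge assms(5) by simp
qed

section \<open>Transport along injective relabellings of vertices\<close>

lemma simple_graph_map_graph:
  assumes "simple_graph G" "inj_on f (verts G)"
  shows "simple_graph (map_graph f G)"
  unfolding simple_graph_def
proof (intro conjI subsetI)
  show "finite (verts (map_graph f G))"
    using assms by (simp add: simple_graph_def map_graph_def)
  fix e assume "e \<in> edges (map_graph f G)"
  then obtain d where d: "d \<in> edges G" "e = f ` d" by (auto simp: map_graph_def)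
  obtain u v where uv: "d = {u, v}" "u \<in> verts G" "v \<in> verts G" "u \<noteq> v"
    using simple_graph_edgeE[OF assms(1) d(1)] .
  then have "f u \<noteq> f v" using assms(2) by (auto dest: inj_onD)
  then show "e \<in> [verts (map_graph f G)]\<^bsup>2\<^esup>" using uv d(2) by (auto simp: nsets_def map_graph_def)
qed

lemma edge_map_graphE:
  assumes "simple_graph G" "inj_on f (verts G)" "{a, b} \<in> edges (map_graph f G)"
  obtains u v where "a = f u" "b = f v" "{u, v} \<in> edges G" "u \<in> verts G" "v \<in> verts G"
proof -
  have "a \<in> f ` verts G" "b \<in> f ` verts G"
    using simple_graph_edgeD[OF simple_graph_map_graph[OF assms(1,2)] assms(3)]
    by (auto simp: map_graph_def)
  then obtain u v where uv: "a = f u" "b = f v" "u \<in> verts G" "v \<in> verts G" by auto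
  then have "{u, v} \<in> edges G" using edge_map_graph_iff[OF assms(1,2)] assms(3) by blast
  then show thesis using uv that by blast
qed

lemma conflict_relation_pullback:
  assumes "simple_graph G" "inj_on f (verts G)" "conflict_relation (map_graph f G) m K"
  shows "conflict_relation G m (\<lambda>u i v j. K (f u) i (f v) j)"
proof -
  have "{f u, f v} \<in> edges (map_graph f G)" if "{u, v} \<in> edges G" for u v
    using simple_graph_edgeD[OF assms(1) that] edge_map_graph_iff[OF assms(1,2)] that by blast
  then show ?thesis using assms(3) unfolding conflict_relation_def by blast
qed

lemma bij_betw_dp_colorings_pullback:
  assumes "simple_graph G" "inj_on f (verts G)"
  shows "bij_betw (\<lambda>c. \<lambda>u\<in>verts G. c (f u)) (dp_colorings (map_graph f G) m K)
    (dp_colorings G m (\<lambda>u i v j. K (f u) i (f v) j))"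
proof (rule bij_betw_byWitness[where f' = "\<lambda>c. \<lambda>a\<in>f ` verts G. c (inv_into (verts G) f a)"])
  have vm: "verts (map_graph f G) = f ` verts G" by (simp add: map_graph_def)
  have inv: "inv_into (verts G) f (f u) = u" if "u \<in> verts G" for u
    using assms(2) that by (rule inv_into_f_f)
  show "\<forall>c\<in>dp_colorings (map_graph f G) m K.
      (\<lambda>a\<in>f ` verts G. (\<lambda>u\<in>verts G. c (f u)) (inv_into (verts G) f a)) = c"
  proof (intro ballI ext)
    fix c a assume "c \<in> dp_colorings (map_graph f G) m K"
    then have "c \<in> f ` verts G \<rightarrow>\<^sub>E {..<m}" by (simp add: dp_colorings_def vm)
    then have "c a = undefined" if "a \<notin> f ` verts G" using that by (rule PiE_arb)
    then show "(\<lambda>a\<in>f ` verts G. (\<lambda>u\<in>verts G. c (f u)) (inv_into (verts G) f a)) a = c a"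
      by (cases "a \<in> f ` verts G") (auto simp: inv)
  qed
  show "\<forall>c\<in>dp_colorings G m (\<lambda>u i v j. K (f u) i (f v) j).
      (\<lambda>u\<in>verts G. (\<lambda>a\<in>f ` verts G. c (inv_into (verts G) f a)) (f u)) = c"
  proof (intro ballI ext)
    fix c u assume "c \<in> dp_colorings G m (\<lambda>u i v j. K (f u) i (f v) j)"
    then have "c \<in> verts G \<rightarrow>\<^sub>E {..<m}" by (simp add: dp_colorings_def)
    then have "c u = undefined" if "u \<notin> verts G" using that by (rule PiE_arb)
    then show "(\<lambda>u\<in>verts G. (\<lambda>a\<in>f ` verts G. c (inv_into (verts G) f a)) (f u)) u = c u"
      by (cases "u \<in> verts G") (auto simp: inv)
  qed
  show "(\<lambda>c. \<lambda>u\<in>verts G. c (f u)) ` dp_colorings (map_graph f G) m K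
      \<subseteq> dp_colorings G m (\<lambda>u i v j. K (f u) i (f v) j)"
  proof (intro image_subsetI)
    fix c assume c: "c \<in> dp_colorings (map_graph f G) m K"
    have "\<not> K (f u) (c (f u)) (f v) (c (f v))" if "{u, v} \<in> edges G" for u v
      using c edge_map_graph_iff[OF assms simple_graph_edgeD(1,2)[OF assms(1) that]] that
      by (simp add: dp_colorings_def)
    then show "(\<lambda>u\<in>verts G. c (f u)) \<in> dp_colorings G m (\<lambda>u i v j. K (f u) i (f v) j)"
      using c simple_graph_edgeD(1,2)[OF assms(1)] by (auto simp: dp_colorings_def vm)
  qed
  show "(\<lambda>c. \<lambda>a\<in>f ` verts G. c (inv_into (verts G) f a)) `
      dp_colorings G m (\<lambda>u i v j. K (f u) i (f v) j) \<subseteq> dp_colorings (map_graph f G) m K"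
  proof (intro image_subsetI)
    fix c assume c: "c \<in> dp_colorings G m (\<lambda>u i v j. K (f u) i (f v) j)"
    let ?c = "\<lambda>a\<in>f ` verts G. c (inv_into (verts G) f a)"
    have "\<not> K a (?c a) b (?c b)" if ab: "{a, b} \<in> edges (map_graph f G)" for a b
    proof -
      obtain u v where "a = f u" "b = f v" "{u, v} \<in> edges G" "u \<in> verts G" "v \<in> verts G"
        using edge_map_graphE[OF assms ab] .
      then show ?thesis using c by (simp add: dp_colorings_def inv)
    qed
    moreover have "?c \<in> f ` verts G \<rightarrow>\<^sub>E {..<m}"
      using c by (auto simp: inv dest: dp_colorings_lt)
    ultimately show "?c \<in> dp_colorings (map_graph f G) m K"
      unfolding dp_colorings_def vm by blast
  qed
qed

lemma card_rooted_colorings_pullback: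
  assumes "simple_graph G" "inj_on f (verts G)" "v \<in> verts G"
  shows "card (rooted_colorings (map_graph f G) m K (f v) x) =
    card (rooted_colorings G m (\<lambda>u i v j. K (f u) i (f v) j) v x)"
  unfolding rooted_colorings_def using assms(3)
  by (intro bij_betw_same_card[OF bij_betw_Collect[OF bij_betw_dp_colorings_pullback[OF assms(1,2)]]]) simp

lemma P_DP_le_map_graph:
  assumes "simple_graph G" "inj_on f (verts G)" "1 \<le> m"
  shows "P_DP G m \<le> P_DP (map_graph f G) m"
proof -
  obtain K where K: "conflict_relation (map_graph f G) m K"
    "P_DP (map_graph f G) m = card (dp_colorings (map_graph f G) m K)"
    using P_DP_attained_conflict[OF simple_graph_map_graph[OF assms(1,2)] assms(3)] .
  then show ?thesis
    using P_DP_le_conflict[OF assms(1,3) conflict_relation_pullback[OF assms(1,2) K(1)]]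
      bij_betw_same_card[OF bij_betw_dp_colorings_pullback[OF assms(1,2)]] by metis
qed

lemma map_graph_inv_into:
  assumes "simple_graph G" "inj_on f (verts G)"
  shows "map_graph (inv_into (verts G) f) (map_graph f G) = G"
proof -
  have "inv_into (verts G) f ` f ` d = d" if "d \<subseteq> verts G" for d
    using assms(2) that by (rule inv_into_image_cancel)
  moreover have "d \<subseteq> verts G" if "d \<in> edges G" for d
    using assms(1) that by (auto simp: simple_graph_def nsets_def)
  ultimately show ?thesis by (simp add: map_graph_def image_image)
qed

text \<open>An optimal conflict relation of the image pulls back along \<open>f\<close>, which gives
  one inequality; the other is the same inequality for the inverse relabelling.\<close>

lemma P_DP_map_graph:
  assumes "simple_graph G" "inj_on f (verts G)" "1 \<le> m"
  shows "P_DP (map_graph f G) m = P_DP G m"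
proof (rule antisym)
  have "inj_on (inv_into (verts G) f) (verts (map_graph f G))"
    by (simp add: map_graph_def inj_on_inv_into)
  from P_DP_le_map_graph[OF simple_graph_map_graph[OF assms(1,2)] this assms(3)]
  show "P_DP (map_graph f G) m \<le> P_DP G m" by (simp add: map_graph_inv_into[OF assms(1,2)])
qed (rule P_DP_le_map_graph[OF assms])

lemma balanced_at_map_graph:
  assumes "simple_graph G" "inj_on f (verts G)" "1 \<le> m" "v \<in> verts G" "balanced_at G m v"
  shows "balanced_at (map_graph f G) m (f v)"
  unfolding balanced_at_def P_DP_map_graph[OF assms(1-3)] card_rooted_colorings_pullback[OF assms(1,2,4)]
  using assms(5) conflict_relation_pullback[OF assms(1,2)] unfolding balanced_at_def by blast

section \<open>Gluing two graphs at a vertex\<close>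

definition graph_union :: "'a ugraph \<Rightarrow> 'a ugraph \<Rightarrow> 'a ugraph" where
  "graph_union G\<^sub>1 G\<^sub>2 = \<lparr>verts = verts G\<^sub>1 \<union> verts G\<^sub>2, edges = edges G\<^sub>1 \<union> edges G\<^sub>2\<rparr>"

lemma graph_union_simps [simp]:
  "verts (graph_union G\<^sub>1 G\<^sub>2) = verts G\<^sub>1 \<union> verts G\<^sub>2"
  "edges (graph_union G\<^sub>1 G\<^sub>2) = edges G\<^sub>1 \<union> edges G\<^sub>2"
  by (simp_all add: graph_union_def)

lemma simple_graph_union:
  assumes "simple_graph G\<^sub>1" "simple_graph G\<^sub>2"
  shows "simple_graph (graph_union G\<^sub>1 G\<^sub>2)"
  using assms unfolding simple_graph_def by (auto simp: nsets_def)

text \<open>Every edge lies within one part and the parts share only \<open>w\<close>. Once the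
  colour of \<open>w\<close> is fixed, colourings of the parts agree on the overlap and combine
  freely.\<close>

lemma card_rooted_colorings_union:
  assumes G: "simple_graph G\<^sub>1" "simple_graph G\<^sub>2" and w: "verts G\<^sub>1 \<inter> verts G\<^sub>2 = {w}"
  shows "card (rooted_colorings (graph_union G\<^sub>1 G\<^sub>2) m K w x) =
    card (rooted_colorings G\<^sub>1 m K w x) * card (rooted_colorings G\<^sub>2 m K w x)"
proof -
  let ?V = "verts G\<^sub>1" and ?W = "verts G\<^sub>2"
  let ?R = "\<lambda>c. (restrict c ?V, restrict c ?W)"
  let ?J = "\<lambda>(c, d) v. if v \<in> ?V then c v else (d v :: nat)"
  have w1: "w \<in> ?V" "w \<in> ?W" using w by auto
  have "bij_betw ?R (rooted_colorings (graph_union G\<^sub>1 G\<^sub>2) m K w x)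
    (rooted_colorings G\<^sub>1 m K w x \<times> rooted_colorings G\<^sub>2 m K w x)"
  proof (rule bij_betw_byWitness[where f' = ?J])
    show "\<forall>c\<in>rooted_colorings (graph_union G\<^sub>1 G\<^sub>2) m K w x. ?J (?R c) = c"
    proof
      fix c assume "c \<in> rooted_colorings (graph_union G\<^sub>1 G\<^sub>2) m K w x"
      then have "c \<in> ?V \<union> ?W \<rightarrow>\<^sub>E {..<m}" by (simp add: rooted_colorings_def dp_colorings_def)
      then have "c v = undefined" if "v \<notin> ?V \<union> ?W" for v using that by (rule PiE_arb)
      then show "?J (?R c) = c" by (intro ext) auto
    qed
    show "\<forall>p\<in>rooted_colorings G\<^sub>1 m K w x \<times> rooted_colorings G\<^sub>2 m K w x. ?R (?J p) = p"
    proof (clarify, intro conjI ext)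
      fix c d v assume "c \<in> rooted_colorings G\<^sub>1 m K w x" "d \<in> rooted_colorings G\<^sub>2 m K w x"
      then have E: "c \<in> ?V \<rightarrow>\<^sub>E {..<m}" "d \<in> ?W \<rightarrow>\<^sub>E {..<m}" and cd: "c w = d w"
        by (auto simp: rooted_colorings_def dp_colorings_def)
      show "restrict (\<lambda>v. if v \<in> ?V then c v else d v) ?V v = c v"
        using PiE_arb[OF E(1)] by (cases "v \<in> ?V") auto
      show "restrict (\<lambda>v. if v \<in> ?V then c v else d v) ?W v = d v"
        using PiE_arb[OF E(2)] w cd by (cases "v \<in> ?W"; cases "v = w") auto
    qed
    show "?R ` rooted_colorings (graph_union G\<^sub>1 G\<^sub>2) m K w x
        \<subseteq> rooted_colorings G\<^sub>1 m K w x \<times> rooted_colorings G\<^sub>2 m K w x"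
    proof (intro image_subsetI)
      fix c assume c: "c \<in> rooted_colorings (graph_union G\<^sub>1 G\<^sub>2) m K w x"
      have "restrict c ?V \<in> rooted_colorings G\<^sub>1 m K w x"
        using c w1 simple_graph_edgeD(1,2)[OF G(1)]
        by (auto simp: rooted_colorings_def dp_colorings_def)
      moreover have "restrict c ?W \<in> rooted_colorings G\<^sub>2 m K w x"
        using c w1 simple_graph_edgeD(1,2)[OF G(2)]
        by (auto simp: rooted_colorings_def dp_colorings_def)
      ultimately show "?R c \<in> rooted_colorings G\<^sub>1 m K w x \<times> rooted_colorings G\<^sub>2 m K w x" by simp
    qed
    show "?J ` (rooted_colorings G\<^sub>1 m K w x \<times> rooted_colorings G\<^sub>2 m K w x)
        \<subseteq> rooted_colorings (graph_union G\<^sub>1 G\<^sub>2) m K w x"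
    proof (clarify)
      fix c d assume c: "c \<in> rooted_colorings G\<^sub>1 m K w x" and d: "d \<in> rooted_colorings G\<^sub>2 m K w x"
      let ?b = "\<lambda>v. if v \<in> ?V then c v else d v"
      have b1: "?b v = c v" if "v \<in> ?V" for v using that by simp
      have cd: "c w = d w" using c d by (simp add: rooted_colorings_def)
      have b2: "?b v = d v" if "v \<in> ?W" for v
        using that w cd by (cases "v = w") auto
      have "\<not> K u (?b u) v (?b v)" if uv: "{u, v} \<in> edges G\<^sub>1 \<union> edges G\<^sub>2" for u v
        using uv
      proof
        assume e: "{u, v} \<in> edges G\<^sub>1"
        then show ?thesis
          using c b1 simple_graph_edgeD(1,2)[OF G(1) e] by (simp add: rooted_colorings_def dp_colorings_def)
      next
        assume e: "{u, v} \<in> edges G\<^sub>2"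
        then have "\<not> K u (d u) v (d v)" using d by (simp add: rooted_colorings_def dp_colorings_def)
        then show ?thesis
          unfolding b2[OF simple_graph_edgeD(1)[OF G(2) e]] b2[OF simple_graph_edgeD(2)[OF G(2) e]] .
      qed
      moreover have "?b \<in> ?V \<union> ?W \<rightarrow>\<^sub>E {..<m}"
      proof (rule PiE_I)
        have cE: "c \<in> ?V \<rightarrow>\<^sub>E {..<m}" "d \<in> ?W \<rightarrow>\<^sub>E {..<m}"
          using c d by (simp_all add: rooted_colorings_def dp_colorings_def)
        show "?b v \<in> {..<m}" if "v \<in> ?V \<union> ?W" for v using cE that by auto
        show "?b v = undefined" if "v \<notin> ?V \<union> ?W" for v using PiE_arb[OF cE(2)] that by auto
      qed
      moreover have "?b w = x" using c w1 by (simp add: rooted_colorings_def)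
      ultimately show "?b \<in> rooted_colorings (graph_union G\<^sub>1 G\<^sub>2) m K w x"
        unfolding rooted_colorings_def dp_colorings_def graph_union_simps by blast
    qed
  qed
  then show ?thesis by (simp add: bij_betw_same_card card_cartesian_product)
qed

lemma conflict_relation_union:
  "conflict_relation (graph_union G\<^sub>1 G\<^sub>2) m K \<longleftrightarrow> conflict_relation G\<^sub>1 m K \<and> conflict_relation G\<^sub>2 m K"
  unfolding conflict_relation_def graph_union_simps by blast

lemma conflict_relation_cong:
  assumes "\<And>u v i j. {u, v} \<in> edges G \<Longrightarrow> K u i v j \<longleftrightarrow> K' u i v j"
  shows "conflict_relation G m K \<longleftrightarrow> conflict_relation G m K'"
proof -
  have "K v j u i \<longleftrightarrow> K' v j u i" if "{u, v} \<in> edges G" for u v i j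
    using assms[of v u] that by (simp add: insert_commute)
  then show ?thesis using assms unfolding conflict_relation_def by blast
qed

text \<open>Balance bounds both factors of each rooted count of the union from below. Conversely,
  optimal covers of the two parts have constant rooted counts, so they can be put together without
  aligning their colours at \<open>w\<close>, and every rooted count of the union attains the
  bound.\<close>

lemma
  assumes G: "simple_graph G\<^sub>1" "simple_graph G\<^sub>2" and w: "verts G\<^sub>1 \<inter> verts G\<^sub>2 = {w}"
    and m: "1 \<le> m" and bal: "balanced_at G\<^sub>1 m w" "balanced_at G\<^sub>2 m w"
  shows P_DP_graph_union: "m * P_DP (graph_union G\<^sub>1 G\<^sub>2) m = P_DP G\<^sub>1 m * P_DP G\<^sub>2 m"
    and balanced_at_graph_union: "balanced_at (graph_union G\<^sub>1 G\<^sub>2) m w"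
proof -
  let ?G = "graph_union G\<^sub>1 G\<^sub>2"
  let ?N = "\<lambda>G K x. card (rooted_colorings G m K w x)"
  have sG: "simple_graph ?G" using G by (rule simple_graph_union)
  have w1: "w \<in> verts G\<^sub>1" "w \<in> verts G\<^sub>2" "w \<in> verts ?G" using w by auto
  have lower: "P_DP G\<^sub>1 m * P_DP G\<^sub>2 m \<le> m * (m * ?N ?G K x)"
    if "conflict_relation ?G m K" "x < m" for K x
  proof -
    have "P_DP G\<^sub>1 m * P_DP G\<^sub>2 m \<le> (m * ?N G\<^sub>1 K x) * (m * ?N G\<^sub>2 K x)"
      using bal that by (intro mult_mono) (auto simp: balanced_at_def conflict_relation_union)
    also have "\<dots> = m * (m * ?N ?G K x)"
      by (simp add: card_rooted_colorings_union[OF G w])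
    finally show ?thesis .
  qed
  obtain K\<^sub>1 where K1: "conflict_relation G\<^sub>1 m K\<^sub>1" "P_DP G\<^sub>1 m = card (dp_colorings G\<^sub>1 m K\<^sub>1)"
    using P_DP_attained_conflict[OF G(1) m] .
  obtain K\<^sub>2 where K2: "conflict_relation G\<^sub>2 m K\<^sub>2" "P_DP G\<^sub>2 m = card (dp_colorings G\<^sub>2 m K\<^sub>2)"
    using P_DP_attained_conflict[OF G(2) m] .
  \<comment> \<open>The two optimal conflict relations are merged edge by edge; the choice is
    consistent because the parts have no common edge.\<close>
  define K where "K = (\<lambda>u i v j. if {u, v} \<in> edges G\<^sub>1 then K\<^sub>1 u i v j else K\<^sub>2 u i v j)"
  have KK1: "K u i v j = K\<^sub>1 u i v j" if "{u, v} \<in> edges G\<^sub>1" for u i v j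
    using that by (simp add: K_def)
  have KK2: "K u i v j = K\<^sub>2 u i v j" if e: "{u, v} \<in> edges G\<^sub>2" for u i v j
  proof -
    \<comment> \<open>Both ends of a common edge would have to be \<open>w\<close>.\<close>
    have "{u, v} \<notin> edges G\<^sub>1"
      using simple_graph_edgeD(1,2)[OF G(1)] simple_graph_edgeD[OF G(2) e] w
      by (metis IntI singletonD)
    then show ?thesis by (simp add: K_def)
  qed
  have cK: "conflict_relation ?G m K"
    unfolding conflict_relation_union
    using K1(1) K2(1) conflict_relation_cong[of G\<^sub>1 K K\<^sub>1] conflict_relation_cong[of G\<^sub>2 K K\<^sub>2] KK1 KK2
    by metis
  have c1: "dp_colorings G\<^sub>1 m K = dp_colorings G\<^sub>1 m K\<^sub>1"
    by (rule dp_colorings_cong[OF G(1)]) (simp add: KK1)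
  have c2: "dp_colorings G\<^sub>2 m K = dp_colorings G\<^sub>2 m K\<^sub>2"
    by (rule dp_colorings_cong[OF G(2)]) (simp add: KK2)
  have N12: "m * ?N G\<^sub>1 K x = P_DP G\<^sub>1 m" "m * ?N G\<^sub>2 K x = P_DP G\<^sub>2 m" if "x < m" for x
    using balanced_at_card[OF G(1) w1(1) bal(1) K1(1) that K1(2)]
      balanced_at_card[OF G(2) w1(2) bal(2) K2(1) that K2(2)]
    by (simp_all add: rooted_colorings_def c1 c2)
  have N: "m * (m * ?N ?G K x) = P_DP G\<^sub>1 m * P_DP G\<^sub>2 m" if "x < m" for x
    unfolding N12[OF that, symmetric] by (simp add: card_rooted_colorings_union[OF G w])
  have "m * (m * P_DP ?G m) \<le> m * (m * card (dp_colorings ?G m K))"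
    using P_DP_le_conflict[OF sG m cK] by simp
  also have "\<dots> = (\<Sum>x<m. m * (m * ?N ?G K x))"
    by (simp add: card_dp_colorings_eq_sum[OF sG w1(3)] sum_distrib_left)
  also have "\<dots> = m * (P_DP G\<^sub>1 m * P_DP G\<^sub>2 m)" by (simp add: N)
  finally have upper: "m * P_DP ?G m \<le> P_DP G\<^sub>1 m * P_DP G\<^sub>2 m" using m by simp
  obtain K' where K': "conflict_relation ?G m K'" "P_DP ?G m = card (dp_colorings ?G m K')"
    using P_DP_attained_conflict[OF sG m] .
  have "m * (P_DP G\<^sub>1 m * P_DP G\<^sub>2 m) = (\<Sum>x<m. P_DP G\<^sub>1 m * P_DP G\<^sub>2 m)" by simp
  also have "\<dots> \<le> (\<Sum>x<m. m * (m * ?N ?G K' x))" using lower[OF K'(1)] by (intro sum_mono) simp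
  also have "\<dots> = m * (m * P_DP ?G m)"
    by (simp add: K'(2) card_dp_colorings_eq_sum[OF sG w1(3)] sum_distrib_left)
  finally have "P_DP G\<^sub>1 m * P_DP G\<^sub>2 m \<le> m * P_DP ?G m" using m by simp
  with upper show eq: "m * P_DP ?G m = P_DP G\<^sub>1 m * P_DP G\<^sub>2 m" by simp
  \<comment> \<open>By the product formula, \<open>lower\<close> is the balance condition multiplied
    by \<open>m\<close>.\<close>
  show "balanced_at ?G m w"
    unfolding balanced_at_def using lower m by (simp flip: eq)
qed

lemma map_graph_disjoint_union:
  "map_graph f (disjoint_union I Gs) = disjoint_union I (\<lambda>i. map_graph f (Gs i))"
  by (simp add: map_graph_def disjoint_union_def image_UN)

text \<open>The parts are attached one at a time at the same vertex \<open>w\<close>; balance of the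
  union is carried through the induction because the next gluing requires it. Here
  \<open>disjoint_union\<close> is applied to graphs that overlap in \<open>w\<close> and is simply
  their union.\<close>

lemma P_DP_amalgam:
  fixes G :: "nat \<Rightarrow> 'a ugraph"
  assumes "1 \<le> n" "1 \<le> m"
    and "\<And>i. i \<in> {1..n} \<Longrightarrow> simple_graph (G i)"
    and "\<And>i. i \<in> {1..n} \<Longrightarrow> w \<in> verts (G i)"
    and "\<And>i. i \<in> {1..n} \<Longrightarrow> balanced_at (G i) m w"
    and "\<And>i j. i \<in> {1..n} \<Longrightarrow> j \<in> {1..n} \<Longrightarrow> i \<noteq> j \<Longrightarrow> verts (G i) \<inter> verts (G j) \<subseteq> {w}"
  shows "simple_graph (disjoint_union {1..n} G) \<and> balanced_at (disjoint_union {1..n} G) m w \<and>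
    m ^ (n - 1) * P_DP (disjoint_union {1..n} G) m = (\<Prod>i=1..n. P_DP (G i) m)"
  using assms(1,3-6)
proof (induction n rule: nat_induct_at_least)
  case base
  moreover have "disjoint_union {1..1} G = G 1"
    by (cases "G 1") (simp add: disjoint_union_def)
  ultimately show ?case by simp
next
  case (Suc n)
  let ?U = "disjoint_union {1..n} G"
  have IH: "simple_graph ?U" "balanced_at ?U m w"
    "m ^ (n - 1) * P_DP ?U m = (\<Prod>i=1..n. P_DP (G i) m)"
    using Suc.IH Suc.prems by auto
  have eq: "disjoint_union {1..Suc n} G = graph_union ?U (G (Suc n))"
    by (auto simp: disjoint_union_def graph_union_def atLeastAtMostSuc_conv)
  have last: "simple_graph (G (Suc n))" "balanced_at (G (Suc n)) m w" using Suc.prems by auto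
  have "verts (G i) \<inter> verts (G (Suc n)) \<subseteq> {w}" if "i \<in> {1..n}" for i
    using Suc.prems(4)[of i "Suc n"] that by auto
  moreover have "w \<in> verts ?U" "w \<in> verts (G (Suc n))"
    using Suc.prems(2) Suc.hyps by (auto simp: disjoint_union_def intro!: bexI[of _ 1])
  ultimately have w: "verts ?U \<inter> verts (G (Suc n)) = {w}"
    unfolding disjoint_union_def ugraph.simps by blast
  have "m ^ n = m ^ (n - 1) * m" using Suc.hyps by (cases n) auto
  then have "m ^ (Suc n - 1) * P_DP (graph_union ?U (G (Suc n))) m =
      m ^ (n - 1) * (m * P_DP (graph_union ?U (G (Suc n))) m)" by simp
  also have "\<dots> = (m ^ (n - 1) * P_DP ?U m) * P_DP (G (Suc n)) m"
    using P_DP_graph_union[OF IH(1) last(1) w \<open>1 \<le> m\<close> IH(2) last(2)] by simp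
  also have "\<dots> = (\<Prod>i=1..Suc n. P_DP (G i) m)" using IH(3) by (simp add: atLeastAtMostSuc_conv)
  finally show ?case
    unfolding eq using simple_graph_union[OF IH(1) last(1)]
      balanced_at_graph_union[OF IH(1) last(1) w \<open>1 \<le> m\<close> IH(2) last(2)] by simp
qed

subsection \<open>Simplicial vertices of chordal graphs\<close>

text \<open>A shortest walk is induced.\<close>

lemma exists_induced_walk:
  assumes "xs \<noteq> []" "hd xs = a" "last xs = b" "set xs \<subseteq> A" "successively R xs"
  obtains ys where "ys \<noteq> []" "hd ys = a" "last ys = b" "set ys \<subseteq> A" "successively R ys"
    "distinct ys" "\<forall>p x q y r. ys = p @ x # q @ y # r \<longrightarrow> R x y \<longrightarrow> q = []"
proof -
  let ?W = "\<lambda>ys. ys \<noteq> [] \<and> hd ys = a \<and> last ys = b \<and> set ys \<subseteq> A \<and> successively R ys"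
  obtain ys where ys: "?W ys" and min: "\<And>zs. ?W zs \<Longrightarrow> length ys \<le> length zs"
    using ex_has_least_nat[of ?W xs length] assms by auto
  have "distinct ys"
  proof (rule ccontr)
    assume "\<not> distinct ys"
    then obtain p q r y where dec: "ys = p @ y # q @ y # r"
      using not_distinct_decomp[of ys] by auto
    \<comment> \<open>The detour between two visits of \<open>y\<close> is cut out.\<close>
    have "?W (p @ y # r)"
      using ys unfolding dec
      by (cases p; cases r) (auto simp: successively_append_iff successively_Cons hd_append split: if_splits)
    then show False using min[of "p @ y # r"] by (simp add: dec)
  qed
  moreover have "q = []" if dec: "ys = p @ x # q @ y # r" and "R x y" for p x q y r
  proof (rule ccontr)
    assume "q \<noteq> []"
    \<comment> \<open>The relation between \<open>x\<close> and \<open>y\<close> provides a shortcut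
      past \<open>q\<close>.\<close>
    have "?W (p @ x # y # r)"
      using ys \<open>R x y\<close> unfolding dec
      by (cases p; cases r) (auto simp: successively_append_iff successively_Cons hd_append split: if_splits)
    then show False using min[of "p @ x # y # r"] \<open>q \<noteq> []\<close> by (simp add: dec)
  qed
  ultimately show thesis using ys that by blast
qed

lemma rtrancl_walk:
  assumes "(a, b) \<in> {(x, y). x \<in> A \<and> y \<in> A \<and> R x y}\<^sup>*" "a \<in> A"
  obtains xs where "xs \<noteq> []" "hd xs = a" "last xs = b" "set xs \<subseteq> A" "successively R xs"
proof -
  have "\<exists>xs. xs \<noteq> [] \<and> hd xs = a \<and> last xs = b \<and> set xs \<subseteq> A \<and> successively R xs"
    using assms(1)
  proof (induction rule: rtrancl_induct)
    case base
    show ?case using assms(2) by (intro exI[of _ "[a]"]) simp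
  next
    case (step y z)
    then obtain xs where "xs \<noteq> []" "hd xs = a" "last xs = y" "set xs \<subseteq> A" "successively R xs" by blast
    with step(2) show ?case
      by (intro exI[of _ "xs @ [z]"]) (auto simp: successively_append_iff)
  qed
  then show thesis using that by blast
qed

text \<open>Otherwise a shortest walk from \<open>a\<close> to \<open>b\<close> with inner vertices
  in \<open>D\<close>, closed up through \<open>v\<close>, is a cycle of length at least 4. A chord
  cannot end at \<open>v\<close>, which has no neighbour in \<open>D\<close>, and cannot join two
  vertices of the walk, which is induced.\<close>

lemma chordal_attachment_clique:
  assumes G: "simple_graph G" "chordal G"
    and D: "\<And>x. x \<in> D \<Longrightarrow> x \<in> verts G \<and> x \<noteq> v \<and> {v, x} \<notin> edges G"
    and ab: "a \<noteq> b" "{v, a} \<in> edges G" "{v, b} \<in> edges G"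
    and pq: "p \<in> D" "{a, p} \<in> edges G" "{q, b} \<in> edges G"
      "(p, q) \<in> {(x, y). x \<in> D \<and> y \<in> D \<and> {x, y} \<in> edges G}\<^sup>*"
  shows "{a, b} \<in> edges G"
proof (rule ccontr)
  assume nab: "{a, b} \<notin> edges G"
  let ?R = "\<lambda>x y. {x, y} \<in> edges G"
  note va = simple_graph_edgeD[OF G(1) ab(2)] and vb = simple_graph_edgeD[OF G(1) ab(3)]
  obtain ws where ws: "ws \<noteq> []" "hd ws = p" "last ws = q" "set ws \<subseteq> D" "successively ?R ws"
    using rtrancl_walk[OF pq(4,1)] .
  have walk: "a # ws @ [b] \<noteq> []" "hd (a # ws @ [b]) = a" "last (a # ws @ [b]) = b" by simp_all
  have succ: "successively ?R (a # ws @ [b])"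
    using ws pq by (auto simp: successively_append_iff successively_Cons)
  have sub: "set (a # ws @ [b]) \<subseteq> insert a (insert b D)" using ws by auto
  obtain xs where xs: "xs \<noteq> []" "hd xs = a" "last xs = b" "set xs \<subseteq> insert a (insert b D)"
    "successively ?R xs" "distinct xs"
    and ind: "\<forall>p x q y r. xs = p @ x # q @ y # r \<longrightarrow> ?R x y \<longrightarrow> q = []"
    using exists_induced_walk[OF walk sub succ] .
  have len: "3 \<le> length xs"
  proof (rule ccontr)
    assume "\<not> 3 \<le> length xs"
    then consider x where "xs = [x]" | x y where "xs = [x, y]"
      using xs(1) by (cases xs; cases "tl xs"; cases "tl (tl xs)") auto
    then show False using xs ab(1) nab by cases auto
  qed
  define ys where "ys = v # xs"
  have lys: "length ys = Suc (length xs)" by (simp add: ys_def)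
  \<comment> \<open>Prepending \<open>v\<close> shifts the walk indices by one; the edge that wraps
    around, at index \<open>length xs\<close>, is \<open>{b, v}\<close>.\<close>
  have e0: "{v, a} = {ys ! 0, ys ! (Suc 0 mod length ys)}"
    using xs(1,2) by (simp add: ys_def hd_conv_nth)
  have en: "{v, b} = {ys ! length xs, ys ! (Suc (length xs) mod length ys)}"
    using xs(1,3) by (auto simp: ys_def last_conv_nth nth_Cons' insert_commute)
  have ei: "{xs ! i, xs ! Suc i} = {ys ! Suc i, ys ! (Suc (Suc i) mod length ys)}"
    if "Suc i < length xs" for i using that by (simp add: ys_def)
  have "v \<notin> set xs" using xs(4) D va vb by blast
  have "cycle_in ys G" unfolding cycle_in_def
  proof (intro conjI)
    show "3 \<le> length ys" "distinct ys" using len xs(6) \<open>v \<notin> set xs\<close> by (simp_all add: ys_def)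
    show "set ys \<subseteq> verts G" using xs(4) D va vb by (auto simp: ys_def)
    show "cycle_edges ys \<subseteq> edges G"
    proof
      fix e assume "e \<in> cycle_edges ys"
      then obtain i where i: "i < length ys" "e = {ys ! i, ys ! (Suc i mod length ys)}"
        by (auto simp: cycle_edges_def)
      consider "i = 0" | "i = length xs" | j where "i = Suc j" "Suc j < length xs"
        using i(1) lys by (cases i) fastforce+
      then show "e \<in> edges G"
      proof cases
        case 1 then show ?thesis using i(2) e0 ab(2) by simp
      next
        case 2 then show ?thesis using i(2) en ab(3) by simp
      next
        case 3
        then show ?thesis using i(2) ei[of j] successively_nth[OF xs(5), of j] by simp
      qed
    qed
  qed
  moreover have "4 \<le> length ys" using len lys by simp
  ultimately obtain e where e: "e \<in> edges G" "e \<subseteq> set ys" "e \<notin> cycle_edges ys"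
    using G(2) unfolding chordal_def by blast
  obtain s t where st: "e = {s, t}" "s \<noteq> t" using simple_graph_edgeE[OF G(1) e(1)] by metis
  have ce: "{ys ! i, ys ! (Suc i mod length ys)} \<in> cycle_edges ys" if "i < length ys" for i
    using that unfolding cycle_edges_def by blast
  \<comment> \<open>The only neighbours of \<open>v\<close> on the walk are \<open>a\<close> and
    \<open>b\<close>, and the edges to them belong to the cycle.\<close>
  have notv: False if "e = {v, t}" "t \<in> set xs" for t
  proof -
    have "t = a \<or> t = b" using xs(4) D that e(1) by blast
    moreover have "{v, a} \<in> cycle_edges ys" unfolding e0 using lys by (intro ce) simp
    moreover have "{v, b} \<in> cycle_edges ys" unfolding en using lys by (intro ce) simp
    ultimately show False using e(3) that(1) by metis
  qed
  \<comment> \<open>Adjacent vertices of an induced walk are consecutive, so their edge belongs to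
    the cycle.\<close>
  have inner: False if "e = {s, t}" "xs = p @ s # q @ t # r" for s t p q r
  proof -
    have "q = []" using ind that(2) e(1) that(1) by blast
    then have "e = {xs ! length p, xs ! Suc (length p)}" "Suc (length p) < length xs"
      using that by (auto simp: nth_append)
    then have "e \<in> cycle_edges ys"
      using ei[of "length p"] ce[of "Suc (length p)"] lys by simp
    then show False using e(3) by simp
  qed
  have sx: "s \<in> set xs" "t \<in> set xs"
    using st e(2) notv[of t] notv[of s] by (auto simp: ys_def insert_commute)
  obtain p r where p: "xs = p @ s # r" using split_list[OF sx(1)] by blast
  then have "t \<in> set p \<or> t \<in> set r" using sx(2) st(2) by auto
  then show False
  proof
    assume "t \<in> set p"
    then obtain p1 p2 where "p = p1 @ t # p2" using split_list by metis
    then show False using inner[of t s p1 p2 r] p st(1) by (simp add: insert_commute)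
  next
    assume "t \<in> set r"
    then obtain p1 p2 where "r = p1 @ t # p2" using split_list by metis
    then show False using inner[of s t p p1 p2] p st(1) by simp
  qed
qed

definition induced_subgraph :: "'a ugraph \<Rightarrow> 'a set \<Rightarrow> 'a ugraph" where
  "induced_subgraph G W = \<lparr>verts = W, edges = {e \<in> edges G. e \<subseteq> W}\<rparr>"

lemma induced_subgraph_simps [simp]:
  "verts (induced_subgraph G W) = W"
  "e \<in> edges (induced_subgraph G W) \<longleftrightarrow> e \<in> edges G \<and> e \<subseteq> W"
  by (auto simp: induced_subgraph_def)

lemma simple_graph_induced_subgraph:
  assumes "simple_graph G" "W \<subseteq> verts G"
  shows "simple_graph (induced_subgraph G W)"
  using assms unfolding simple_graph_def
  by (auto simp: nsets_def induced_subgraph_def intro: finite_subset)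

text \<open>A chord has both ends on its cycle, so it survives in any induced subgraph that contains
  the cycle.\<close>

lemma chordal_induced_subgraph:
  assumes "chordal G" "W \<subseteq> verts G"
  shows "chordal (induced_subgraph G W)"
  unfolding chordal_def
proof (intro allI impI)
  fix xs assume xs: "cycle_in xs (induced_subgraph G W) \<and> 4 \<le> length xs"
  then have W: "set xs \<subseteq> W" by (simp add: cycle_in_def)
  have "cycle_in xs G" using xs assms(2) by (auto simp: cycle_in_def subset_iff)
  then obtain e where "e \<in> edges G" "e \<subseteq> set xs" "e \<notin> cycle_edges xs"
    using assms(1) xs unfolding chordal_def by blast
  then show "\<exists>e\<in>edges (induced_subgraph G W). e \<subseteq> set xs \<and> e \<notin> cycle_edges xs"
    using W by (intro bexI[of _ e]) auto
qed

definition simplicial :: "'a ugraph \<Rightarrow> 'a \<Rightarrow> bool" where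
  "simplicial G s \<longleftrightarrow> s \<in> verts G \<and>
     (\<forall>a b. {s, a} \<in> edges G \<and> {s, b} \<in> edges G \<and> a \<noteq> b \<longrightarrow> {a, b} \<in> edges G)"

text \<open>Let \<open>C\<close> be a component of the non-neighbours of \<open>v\<close> and \<open>S\<close> its attachment set, a clique by
  \<open>chordal_attachment_clique\<close>. Induction applied to \<open>C \<union> S\<close> at a suitable vertex yields a simplicial
  vertex outside \<open>S\<close>.\<close>

lemma chordal_simplicial_nonneighbour:
  assumes "simple_graph G" "chordal G" "v \<in> verts G" "u \<in> verts G" "u \<noteq> v" "{v, u} \<notin> edges G"
  shows "\<exists>s. simplicial G s \<and> s \<noteq> v \<and> {v, s} \<notin> edges G"
  using assms
proof (induction "card (verts G)" arbitrary: G v u rule: less_induct)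
  case less
  note G = less.prems(1,2)
  define D where "D = {x \<in> verts G. x \<noteq> v \<and> {v, x} \<notin> edges G}"
  define r where "r = {(x, y). x \<in> D \<and> y \<in> D \<and> {x, y} \<in> edges G}"
  define C where "C = r\<^sup>* `` {u}"
  define S where "S = {a. a \<notin> C \<and> (\<exists>c\<in>C. {a, c} \<in> edges G)}"
  have uD: "u \<in> D" using less.prems by (simp add: D_def)
  have uC: "u \<in> C" by (simp add: C_def)
  have CD: "C \<subseteq> D"
  proof
    fix x assume "x \<in> C"
    then have "(u, x) \<in> r\<^sup>*" by (simp add: C_def)
    then show "x \<in> D" using uD by (induction rule: rtrancl_induct) (auto simp: r_def)
  qed
  have "sym r" by (auto simp: r_def sym_def insert_commute)
  then have conn: "(c, d) \<in> r\<^sup>*" if "c \<in> C" "d \<in> C" for c d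
    using that unfolding C_def by (meson Image_singleton_iff rtrancl_trans symD sym_rtrancl)
  have closed: "d \<in> C" if "c \<in> C" "d \<in> D" "{c, d} \<in> edges G" for c d
  proof -
    have "(c, d) \<in> r" using that CD by (auto simp: r_def)
    then show ?thesis using that(1) unfolding C_def by (auto intro: rtrancl_into_rtrancl)
  qed
  have SV: "S \<subseteq> verts G" using simple_graph_edgeD(1)[OF G(1)] by (auto simp: S_def)
  \<comment> \<open>A vertex of \<open>D\<close> adjacent to the component \<open>C\<close> would
    belong to \<open>C\<close>, so the attachment vertices are neighbours of
    \<open>v\<close>.\<close>
  have Sv: "{v, a} \<in> edges G" if a: "a \<in> S" for a
  proof -
    obtain c where c: "c \<in> C" "{a, c} \<in> edges G" "a \<notin> C" using a by (auto simp: S_def)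
    then have "a \<notin> D" using closed[of c a] by (auto simp: insert_commute)
    moreover have "a \<noteq> v" using c CD by (auto simp: D_def)
    ultimately show ?thesis using SV a by (auto simp: D_def)
  qed
  have S_clique: "{a, b} \<in> edges G" if a: "a \<in> S" and b: "b \<in> S" and "a \<noteq> b" for a b
  proof -
    obtain p q where pq: "p \<in> C" "{a, p} \<in> edges G" "q \<in> C" "{b, q} \<in> edges G"
      using a b by (auto simp: S_def)
    show ?thesis
      by (rule chordal_attachment_clique[OF G, of D v a b p q])
        (use pq Sv[OF a] Sv[OF b] \<open>a \<noteq> b\<close> CD conn[OF pq(1,3)] in
          \<open>auto simp: D_def r_def insert_commute\<close>)
  qed
  define W where "W = C \<union> S"
  let ?G = "induced_subgraph G W"
  have WV: "W \<subseteq> verts G" using CD SV by (auto simp: W_def D_def)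
  have "v \<notin> S" using Sv[of v] simple_graph_edgeD(3)[OF G(1), of v v] by blast
  then have "v \<notin> W" using CD by (auto simp: W_def D_def)
  then have "W \<subset> verts G" using WV less.prems(3) by blast
  then have card: "card W < card (verts G)"
    using G(1) by (intro psubset_card_mono) (auto simp: simple_graph_def)
  \<comment> \<open>All neighbours of a vertex of \<open>C\<close> stay in \<open>W\<close>; hence
    being simplicial in \<open>?G\<close> transfers to \<open>G\<close> for such a vertex.\<close>
  have nbr: "a \<in> W" if "s \<in> C" "{s, a} \<in> edges G" for s a
    using that by (auto simp: W_def S_def insert_commute)
  have IH: "\<exists>s. simplicial ?G s \<and> s \<noteq> y \<and> {y, s} \<notin> edges G"
    if yz: "y \<in> W" "z \<in> W" "z \<noteq> y" "{y, z} \<notin> edges G" for y z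
  proof -
    obtain s where s: "simplicial ?G s" "s \<noteq> y" "{y, s} \<notin> edges ?G"
      using less.hyps[of ?G y z] card simple_graph_induced_subgraph[OF G(1) WV]
        chordal_induced_subgraph[OF G(2) WV] yz by auto
    then have "s \<in> W" by (simp add: simplicial_def)
    then show ?thesis using s yz(1) by auto
  qed
  have "\<exists>s\<in>C. simplicial ?G s"
  proof (cases "\<exists>a\<in>S. \<exists>z\<in>W. z \<noteq> a \<and> {a, z} \<notin> edges G")
    case True
    \<comment> \<open>Induction at \<open>a\<close> gives a simplicial vertex not adjacent to
      \<open>a\<close>; it avoids \<open>S\<close>, which is a clique containing
      \<open>a\<close>.\<close>
    then obtain a z where az: "a \<in> S" "z \<in> W" "z \<noteq> a" "{a, z} \<notin> edges G" by blast
    then obtain s where s: "simplicial ?G s" "s \<noteq> a" "{a, s} \<notin> edges G"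
      using IH[of a z] by (auto simp: W_def)
    then have "s \<notin> S" using S_clique[OF az(1)] by metis
    then show ?thesis using s(1) by (auto simp: simplicial_def W_def)
  next
    case univ: False
    show ?thesis
    proof (cases "\<exists>y\<in>W. \<exists>z\<in>W. z \<noteq> y \<and> {y, z} \<notin> edges G")
      case True
      then obtain y z where yz: "y \<in> W" "z \<in> W" "z \<noteq> y" "{y, z} \<notin> edges G" by blast
      then obtain s where s: "simplicial ?G s" "s \<noteq> y" "{y, s} \<notin> edges G"
        using IH[of y z] by blast
      \<comment> \<open>Here every vertex of \<open>S\<close> is adjacent to all others of
        \<open>W\<close>, so a vertex not adjacent to \<open>y\<close> lies outside
        \<open>S\<close>.\<close>
      then have "s \<notin> S" using univ yz(1) by (metis insert_commute)
      then show ?thesis using s(1) by (auto simp: simplicial_def W_def)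
    next
      case False
      \<comment> \<open>Now \<open>W\<close> is complete and \<open>u\<close> itself serves.\<close>
      then have "{y, z} \<in> edges G" if "y \<in> W" "z \<in> W" "z \<noteq> y" for y z using that by blast
      moreover have "u \<in> W" using uC by (simp add: W_def)
      ultimately have "simplicial ?G u" by (auto simp: simplicial_def)
      then show ?thesis using uC by blast
    qed
  qed
  then obtain s where s: "s \<in> C" "simplicial ?G s" by blast
  have "simplicial G s"
    unfolding simplicial_def
  proof (intro conjI allI impI)
    show "s \<in> verts G" using s(1) CD by (auto simp: D_def)
    fix a b assume ab: "{s, a} \<in> edges G \<and> {s, b} \<in> edges G \<and> a \<noteq> b"
    moreover have "a \<in> W" "b \<in> W" "s \<in> W" using nbr[OF s(1)] ab s(1) by (auto simp: W_def)
    ultimately show "{a, b} \<in> edges G" using s(2) by (auto simp: simplicial_def)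
  qed
  then show ?case using s(1) CD by (auto simp: D_def)
qed

text \<open>If \<open>v\<close> has a non-neighbour, the previous lemma applies at \<open>v\<close>.
  If \<open>v\<close> is adjacent to all others but \<open>G\<close> is not complete, it applies at
  some \<open>y\<close>, and its result is not adjacent to \<open>y\<close>, hence not
  \<open>v\<close>. In a complete graph every vertex is simplicial.\<close>

lemma chordal_simplicial_avoiding:
  assumes "simple_graph G" "chordal G" "v \<in> verts G" "verts G \<noteq> {v}"
  obtains s where "simplicial G s" "s \<noteq> v"
proof (cases "\<exists>y\<in>verts G. \<exists>z\<in>verts G. z \<noteq> y \<and> {y, z} \<notin> edges G")
  case True
  show ?thesis
  proof (cases "\<exists>z\<in>verts G. z \<noteq> v \<and> {v, z} \<notin> edges G")
    case True
    then show ?thesis using chordal_simplicial_nonneighbour[OF assms(1-3)] that by blast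
  next
    case univ: False
    obtain y z where yz: "y \<in> verts G" "z \<in> verts G" "z \<noteq> y" "{y, z} \<notin> edges G" using True by blast
    obtain s where s: "simplicial G s" "s \<noteq> y" "{y, s} \<notin> edges G"
      using chordal_simplicial_nonneighbour[OF assms(1,2) yz] by blast
    then have "s \<noteq> v" using univ yz(1) by (metis insert_commute)
    then show ?thesis using s(1) that by blast
  qed
next
  case False
  obtain s where s: "s \<in> verts G" "s \<noteq> v" using assms(3,4) by blast
  have "simplicial G s"
    unfolding simplicial_def using False s(1) simple_graph_edgeD(2)[OF assms(1)] by metis
  then show ?thesis using that s(2) by blast
qed

subsection \<open>Chordal graphs are balanced\<close>

text \<open>Both orders of the arguments of \<open>K\<close> are excluded, as in
  \<open>dp_colorings\<close>, so that extensions can be counted for an arbitrary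
  \<open>K\<close>.\<close>

definition extension_colors where
  "extension_colors G m K s c =
     {b. b < m \<and> (\<forall>t. {s, t} \<in> edges G \<longrightarrow> \<not> K s b t (c t) \<and> \<not> K t (c t) s b)}"

lemma bij_betw_extend_coloring:
  assumes G: "simple_graph G" and s: "s \<in> verts G"
  shows "bij_betw (\<lambda>c. (restrict c (verts G - {s}), c s)) (dp_colorings G m K)
    (SIGMA c:dp_colorings (induced_subgraph G (verts G - {s})) m K. extension_colors G m K s c)"
proof (rule bij_betw_byWitness[where f' = "\<lambda>(c, b). c(s := b)"])
  let ?V = "verts G - {s}"
  let ?D = "dp_colorings (induced_subgraph G ?V) m K"
  have D: "u \<in> verts G" "v \<in> verts G" "u \<noteq> v" if "{u, v} \<in> edges G" for u v
    using simple_graph_edgeD[OF G that] by auto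
  show "\<forall>c\<in>dp_colorings G m K. (\<lambda>(c, b). c(s := b)) (restrict c ?V, c s) = c"
  proof
    fix c assume "c \<in> dp_colorings G m K"
    then have "c \<in> verts G \<rightarrow>\<^sub>E {..<m}" by (simp add: dp_colorings_def)
    then have "c v = undefined" if "v \<notin> verts G" for v using that by (rule PiE_arb)
    then show "(\<lambda>(c, b). c(s := b)) (restrict c ?V, c s) = c" by (auto simp: fun_eq_iff)
  qed
  show "\<forall>p\<in>Sigma ?D (extension_colors G m K s).
      (restrict ((\<lambda>(c, b). c(s := b)) p) ?V, ((\<lambda>(c, b). c(s := b)) p) s) = p"
  proof
    fix p assume "p \<in> Sigma ?D (extension_colors G m K s)"
    then obtain c b where p: "p = (c, b)" "c \<in> ?D" by blast
    then have "c \<in> ?V \<rightarrow>\<^sub>E {..<m}" by (simp add: dp_colorings_def)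
    then have "c v = undefined" if "v \<notin> ?V" for v using that by (rule PiE_arb)
    then show "(restrict ((\<lambda>(c, b). c(s := b)) p) ?V, ((\<lambda>(c, b). c(s := b)) p) s) = p"
      by (auto simp: p(1) fun_eq_iff)
  qed
  show "(\<lambda>c. (restrict c ?V, c s)) ` dp_colorings G m K \<subseteq> Sigma ?D (extension_colors G m K s)"
  proof (intro image_subsetI)
    fix c assume c: "c \<in> dp_colorings G m K"
    have nK: "\<not> K u (c u) v (c v)" if "{u, v} \<in> edges G" for u v
      using c that by (simp add: dp_colorings_def)
    have "restrict c ?V \<in> ?D"
      unfolding dp_colorings_def mem_Collect_eq
    proof (intro conjI allI impI)
      show "restrict c ?V \<in> verts (induced_subgraph G ?V) \<rightarrow>\<^sub>E {..<m}"
        using c by (auto dest: dp_colorings_lt)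
      fix u v assume "{u, v} \<in> edges (induced_subgraph G ?V)"
      then show "\<not> K u (restrict c ?V u) v (restrict c ?V v)" using nK[of u v] by auto
    qed
    moreover have "c s \<in> extension_colors G m K s (restrict c ?V)"
      unfolding extension_colors_def mem_Collect_eq
    proof (intro conjI allI impI)
      show "c s < m" using c s by (rule dp_colorings_lt)
      fix t assume e: "{s, t} \<in> edges G"
      then have "restrict c ?V t = c t" using D[OF e] by auto
      then show "\<not> K s (c s) t (restrict c ?V t)" "\<not> K t (restrict c ?V t) s (c s)"
        using nK[of s t] nK[of t s] e by (auto simp: insert_commute)
    qed
    ultimately show "(restrict c ?V, c s) \<in> Sigma ?D (extension_colors G m K s)" by blast
  qed
  show "(\<lambda>(c, b). c(s := b)) ` Sigma ?D (extension_colors G m K s) \<subseteq> dp_colorings G m K"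
  proof (clarify)
    fix c b assume c: "c \<in> ?D" and b: "b \<in> extension_colors G m K s c"
    have cE: "c \<in> ?V \<rightarrow>\<^sub>E {..<m}" using c by (simp add: dp_colorings_def)
    have b': "b < m" "\<And>t. {s, t} \<in> edges G \<Longrightarrow> \<not> K s b t (c t)"
      "\<And>t. {s, t} \<in> edges G \<Longrightarrow> \<not> K t (c t) s b"
      using b by (auto simp: extension_colors_def)
    show "c(s := b) \<in> dp_colorings G m K"
      unfolding dp_colorings_def mem_Collect_eq
    proof (intro conjI allI impI PiE_I)
      show "(c(s := b)) v \<in> {..<m}" if "v \<in> verts G" for v using that cE b'(1) by auto
      show "(c(s := b)) v = undefined" if "v \<notin> verts G" for v
        using that s PiE_arb[OF cE, of v] by auto
      fix u v assume e: "{u, v} \<in> edges G"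
      have e': "{v, u} \<in> edges G" using e by (simp add: insert_commute)
      have "\<not> K u (c u) v (c v)" if "u \<noteq> s" "v \<noteq> s"
        using c e D[OF e] that by (simp add: dp_colorings_def)
      then show "\<not> K u ((c(s := b)) u) v ((c(s := b)) v)"
        using b'(2)[of v] b'(3)[of u] e e' D(3)[OF e] by auto
    qed
  qed
qed

lemma card_dp_colorings_extend:
  assumes "simple_graph G" "s \<in> verts G"
  shows "card (dp_colorings G m K) =
    (\<Sum>c\<in>dp_colorings (induced_subgraph G (verts G - {s})) m K. card (extension_colors G m K s c))"
proof -
  have "simple_graph (induced_subgraph G (verts G - {s}))"
    using assms(1) by (rule simple_graph_induced_subgraph) auto
  then show ?thesis
    using bij_betw_same_card[OF bij_betw_extend_coloring[OF assms]]
    by (simp add: finite_dp_colorings extension_colors_def)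
qed

lemma card_rooted_colorings_extend:
  assumes "simple_graph G" "s \<in> verts G" "v \<in> verts G" "v \<noteq> s"
  shows "card (rooted_colorings G m K v x) =
    (\<Sum>c\<in>rooted_colorings (induced_subgraph G (verts G - {s})) m K v x.
       card (extension_colors G m K s c))"
proof -
  let ?D = "dp_colorings (induced_subgraph G (verts G - {s})) m K"
  have "simple_graph (induced_subgraph G (verts G - {s}))"
    using assms(1) by (rule simple_graph_induced_subgraph) auto
  then have fin: "finite (rooted_colorings (induced_subgraph G (verts G - {s})) m K v x)"
    by (simp add: rooted_colorings_def finite_dp_colorings)
  have "card (rooted_colorings G m K v x) =
      card {p \<in> (SIGMA c:?D. extension_colors G m K s c). fst p v = x}"
    unfolding rooted_colorings_def using assms(3,4)
    by (intro bij_betw_same_card[OF bij_betw_Collect[OF bij_betw_extend_coloring[OF assms(1,2)]]]) simp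
  also have "{p \<in> (SIGMA c:?D. extension_colors G m K s c). fst p v = x} =
      (SIGMA c:rooted_colorings (induced_subgraph G (verts G - {s})) m K v x. extension_colors G m K s c)"
    by (auto simp: rooted_colorings_def)
  finally show ?thesis using fin by (simp add: extension_colors_def)
qed

text \<open>Each neighbour of \<open>s\<close> forbids at most one colour at \<open>s\<close>, and
  forbidden colours may coincide. Subtraction is truncated, so the bound is trivial once the degree
  reaches \<open>m\<close>.\<close>

lemma card_extension_colors_ge:
  assumes G: "simple_graph G" and s: "s \<in> verts G" and K: "conflict_relation G m K"
    and c: "\<And>t. t \<in> verts G - {s} \<Longrightarrow> c t < m"
  shows "m - card {t. {s, t} \<in> edges G} \<le> card (extension_colors G m K s c)"
proof -
  let ?N = "{t. {s, t} \<in> edges G}"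
  let ?B = "\<lambda>t. {b. b < m \<and> (K s b t (c t) \<or> K t (c t) s b)}"
  have N: "?N \<subseteq> verts G - {s}" using simple_graph_edgeD(2,3)[OF G] by auto
  have finN: "finite ?N" using N G by (auto simp: simple_graph_def intro: finite_subset)
  have one: "card (?B t) \<le> 1" if t: "t \<in> ?N" for t
  proof -
    have ct: "c t < m" using c N t by blast
    have e: "{s, t} \<in> edges G" "{t, s} \<in> edges G" using t by (auto simp: insert_commute)
    \<comment> \<open>Symmetry turns either kind of conflict into \<open>K t (c t) s b\<close>, and
      the colour \<open>c t\<close> has a single partner at \<open>s\<close>.\<close>
    have K1: "K t (c t) s b" if "b \<in> ?B t" for b
      using that K e ct unfolding conflict_relation_def by blast
    have "b = b'" if "b \<in> ?B t" "b' \<in> ?B t" for b b'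
      using K1[OF that(1)] K1[OF that(2)] that K e(2) ct unfolding conflict_relation_def by blast
    then show ?thesis by (simp add: card_le_Suc0_iff_eq)
  qed
  have "{..<m} - (\<Union>t\<in>?N. ?B t) \<subseteq> extension_colors G m K s c"
    by (auto simp: extension_colors_def)
  then have "card ({..<m} - (\<Union>t\<in>?N. ?B t)) \<le> card (extension_colors G m K s c)"
    by (intro card_mono) (auto simp: extension_colors_def)
  moreover have "card (\<Union>t\<in>?N. ?B t) \<le> card ?N"
  proof -
    have "card (\<Union>t\<in>?N. ?B t) \<le> (\<Sum>t\<in>?N. card (?B t))" by (rule card_UN_le[OF finN])
    also have "\<dots> \<le> (\<Sum>t\<in>?N. 1)" using one by (intro sum_mono) simp
    finally show ?thesis by simp
  qed
  moreover have "card {..<m} - card (\<Union>t\<in>?N. ?B t) \<le> card ({..<m} - (\<Union>t\<in>?N. ?B t))"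
    using finN by (intro diff_card_le_card_Diff) auto
  ultimately show ?thesis by simp
qed

text \<open>The neighbours of \<open>s\<close> are pairwise adjacent, so a proper colouring gives
  them distinct colours, and precisely these are forbidden at \<open>s\<close>.\<close>

lemma card_extension_colors_simplicial:
  assumes G: "simple_graph G" and s: "simplicial G s"
    and c: "c \<in> dp_colorings (induced_subgraph G (verts G - {s})) m (\<lambda>u i v j. i = j)"
  shows "card (extension_colors G m (\<lambda>u i v j. i = j) s c) = m - card {t. {s, t} \<in> edges G}"
proof -
  let ?N = "{t. {s, t} \<in> edges G}"
  have N: "?N \<subseteq> verts G - {s}" using simple_graph_edgeD(2,3)[OF G] by auto
  have finN: "finite ?N" using N G by (auto simp: simple_graph_def intro: finite_subset)
  have "inj_on c ?N"
  proof (rule inj_onI, rule ccontr)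
    fix a b assume ab: "a \<in> ?N" "b \<in> ?N" "c a = c b" "a \<noteq> b"
    then have "{a, b} \<in> edges G" using s by (auto simp: simplicial_def)
    moreover have "a \<in> verts G - {s}" "b \<in> verts G - {s}" using N ab by auto
    ultimately have "{a, b} \<in> edges (induced_subgraph G (verts G - {s}))" by simp
    then show False using c ab(3) unfolding dp_colorings_def by blast
  qed
  moreover have sub: "c ` ?N \<subseteq> {..<m}"
    using c N by (auto simp: dp_colorings_def)
  moreover have "extension_colors G m (\<lambda>u i v j. i = j) s c = {..<m} - c ` ?N"
    by (auto simp: extension_colors_def)
  ultimately show ?thesis using finN by (simp add: card_Diff_subset card_image)
qed

text \<open>The left side is the number of proper \<open>m\<close>-colourings. Restoring a
  simplicial vertex of degree \<open>d\<close> multiplies it by exactly \<open>m - d\<close>, while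
  the rooted count grows at least by this factor.\<close>

lemma chordal_rooted_bound:
  assumes "simple_graph G" "chordal G" "v \<in> verts G" "conflict_relation G m K" "x < m"
  shows "card (dp_colorings G m (\<lambda>u i v j. i = j)) \<le> m * card (rooted_colorings G m K v x)"
  using assms
proof (induction "card (verts G)" arbitrary: G rule: less_induct)
  case less
  note G = less.prems(1)
  let ?E = "\<lambda>u i v j. i = j"
  show ?case
  proof (cases "verts G = {v}")
    case True
    have noE: "{u, w} \<notin> edges G" for u w
      using simple_graph_edgeD[OF G, of u w] True by auto
    have "dp_colorings G m ?E \<subseteq> (\<lambda>i. \<lambda>u\<in>{v}. i) ` {..<m}"
    proof
      fix c assume "c \<in> dp_colorings G m ?E"
      then have cE: "c \<in> {v} \<rightarrow>\<^sub>E {..<m}" using True by (simp add: dp_colorings_def)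
      then have "c = (\<lambda>u\<in>{v}. c v)" by (intro PiE_ext[OF cE]) auto
      moreover have "c v < m" using cE by auto
      ultimately show "c \<in> (\<lambda>i. \<lambda>u\<in>{v}. i) ` {..<m}" by blast
    qed
    then have "card (dp_colorings G m ?E) \<le> m"
      by (metis card_lessThan finite_lessThan surj_card_le)
    moreover have "(\<lambda>u\<in>{v}. x) \<in> rooted_colorings G m K v x"
      using True noE less.prems(5) by (auto simp: rooted_colorings_def dp_colorings_def)
    then have "1 \<le> card (rooted_colorings G m K v x)"
      using finite_dp_colorings[OF G] by (auto simp: rooted_colorings_def Suc_le_eq card_gt_0_iff)
    ultimately show ?thesis by (metis le_trans mult.right_neutral mult_le_mono2)
  next
    case False
    \<comment> \<open>Deleting a vertex other than \<open>v\<close> keeps the root in the smaller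
      graph.\<close>
    obtain s where s: "simplicial G s" "s \<noteq> v"
      using chordal_simplicial_avoiding[OF less.prems(1-3) False] .
    have sV: "s \<in> verts G" using s(1) by (simp add: simplicial_def)
    let ?G = "induced_subgraph G (verts G - {s})"
    let ?d = "card {t. {s, t} \<in> edges G}"
    have card: "card (verts ?G) < card (verts G)"
      using sV G by (intro psubset_card_mono) (auto simp: simple_graph_def)
    have sG: "simple_graph ?G" using G by (rule simple_graph_induced_subgraph) auto
    have chG: "chordal ?G" using less.prems(2) by (rule chordal_induced_subgraph) auto
    have "conflict_relation ?G m K"
      using less.prems(4) unfolding conflict_relation_def induced_subgraph_simps by blast
    then have IH: "card (dp_colorings ?G m ?E) \<le> m * card (rooted_colorings ?G m K v x)"
      using less.hyps[OF card sG chG] less.prems(3,5) s(2) by simp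
    have "card (dp_colorings G m ?E) = (m - ?d) * card (dp_colorings ?G m ?E)"
      by (simp add: card_dp_colorings_extend[OF G sV] card_extension_colors_simplicial[OF G s(1)])
    also have "\<dots> \<le> m * ((m - ?d) * card (rooted_colorings ?G m K v x))"
      using mult_le_mono2[OF IH, of "m - ?d"] by (simp add: ac_simps)
    also have "(m - ?d) * card (rooted_colorings ?G m K v x) =
        (\<Sum>c\<in>rooted_colorings ?G m K v x. m - ?d)" by simp
    also have "\<dots> \<le> (\<Sum>c\<in>rooted_colorings ?G m K v x. card (extension_colors G m K s c))"
    proof (intro sum_mono card_extension_colors_ge[OF G sV less.prems(4)])
      show "c t < m" if "c \<in> rooted_colorings ?G m K v x" "t \<in> verts G - {s}" for c t
        using that by (auto simp: rooted_colorings_def dp_colorings_def)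
    qed
    also have "\<dots> = card (rooted_colorings G m K v x)"
      using card_rooted_colorings_extend[OF G sV less.prems(3)] s(2) by simp
    finally show ?thesis by simp
  qed
qed

text \<open>Equality of colours is itself a conflict relation, so the number of proper colourings
  bounds \<open>P_DP G m\<close> from above.\<close>

lemma chordal_balanced_at:
  assumes "simple_graph G" "chordal G" "v \<in> verts G" "1 \<le> m"
  shows "balanced_at G m v"
proof -
  have "conflict_relation G m (\<lambda>u i v j. i = j)" by (auto simp: conflict_relation_def)
  from P_DP_le_conflict[OF assms(1,4) this] show ?thesis
    unfolding balanced_at_def using chordal_rooted_bound[OF assms(1-3)] le_trans by blast
qed

subsection \<open>Cycles are balanced\<close>

text \<open>Vertices are numbered along the cycle, so that they serve as positions of walks; the
  root is placed at \<open>0\<close>.\<close>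

definition std_cycle :: "nat \<Rightarrow> nat ugraph" where
  "std_cycle n = \<lparr>verts = {..<n}, edges = {{i, Suc i mod n} | i. i < n}\<rparr>"

lemma std_cycle_edgeI:
  assumes "3 \<le> n"
  shows "Suc i < n \<Longrightarrow> {i, Suc i} \<in> edges (std_cycle n)" "{n - 1, 0} \<in> edges (std_cycle n)"
proof -
  show "{i, Suc i} \<in> edges (std_cycle n)" if "Suc i < n"
    using that by (auto simp: std_cycle_def intro!: exI[of _ i])
  have "{n - 1, 0} = {n - 1, Suc (n - 1) mod n}" using assms by simp
  then show "{n - 1, 0} \<in> edges (std_cycle n)" using assms unfolding std_cycle_def by force
qed

lemma std_cycle_edgeE:
  assumes "e \<in> edges (std_cycle n)" "3 \<le> n"
  obtains i where "Suc i < n" "e = {i, Suc i}" | "e = {n - 1, 0}"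
proof -
  obtain i where i: "i < n" "e = {i, Suc i mod n}" using assms(1) by (auto simp: std_cycle_def)
  show thesis
  proof (cases "Suc i < n")
    case True then show thesis using i that(1) by simp
  next
    case False
    then have "Suc i = n" using i(1) by simp
    then have "i = n - 1" "Suc i mod n = 0" by auto
    then show thesis using i(2) that(2) by simp
  qed
qed

lemma simple_graph_std_cycle:
  assumes "3 \<le> n"
  shows "simple_graph (std_cycle n)"
  unfolding simple_graph_def
proof (intro conjI subsetI)
  show "finite (verts (std_cycle n))" by (simp add: std_cycle_def)
  fix e assume "e \<in> edges (std_cycle n)"
  then show "e \<in> [verts (std_cycle n)]\<^bsup>2\<^esup>"
    by (rule std_cycle_edgeE[OF _ assms]) (use assms in \<open>auto simp: std_cycle_def nsets_def\<close>)
qed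

lemma cycle_edges_rotate_subset: "cycle_edges (rotate k xs) \<subseteq> cycle_edges xs"
proof
  fix e assume "e \<in> cycle_edges (rotate k xs)"
  then obtain i where i: "i < length xs"
    "e = {rotate k xs ! i, rotate k xs ! (Suc i mod length xs)}"
    by (auto simp: cycle_edges_def)
  let ?j = "(k + i) mod length xs"
  have pos: "0 < length xs" using i(1) by linarith
  then have "Suc i mod length xs < length xs" by (rule mod_less_divisor)
  then have "e = {xs ! ?j, xs ! (Suc ?j mod length xs)}"
    using i by (simp add: nth_rotate mod_simps)
  moreover have "?j < length xs" using pos by (rule mod_less_divisor)
  ultimately show "e \<in> cycle_edges xs" unfolding cycle_edges_def by blast
qed

lemma cycle_edges_rotate:
  assumes "k < length xs"
  shows "cycle_edges (rotate k xs) = cycle_edges xs"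
proof
  have "rotate (length xs - k) (rotate k xs) = xs" using assms by (simp add: rotate_rotate)
  then show "cycle_edges xs \<subseteq> cycle_edges (rotate k xs)"
    using cycle_edges_rotate_subset[of "length xs - k" "rotate k xs"] by simp
qed (rule cycle_edges_rotate_subset)

text \<open>Rotating the vertex list brings \<open>v\<close> to the front without changing the
  edges; \<open>f\<close> is indexing into the rotated list.\<close>

lemma cycle_graph_std_cycle:
  assumes "cycle_graph G" "v \<in> verts G"
  obtains n f where "3 \<le> n" "inj_on f {..<n}" "G = map_graph f (std_cycle n)" "f 0 = v"
proof -
  obtain xs where xs: "3 \<le> length xs" "distinct xs" "verts G = set xs" "edges G = cycle_edges xs"
    using assms(1) by (auto simp: cycle_graph_def)
  obtain k where k: "k < length xs" "xs ! k = v" using assms(2) xs(3) by (auto simp: in_set_conv_nth)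
  define ys where "ys = rotate k xs"
  have ys: "length ys = length xs" "distinct ys" "set ys = set xs" "cycle_edges ys = cycle_edges xs"
    using xs k cycle_edges_rotate by (simp_all add: ys_def)
  have "0 < length xs" using k(1) by linarith
  then have "ys ! 0 = v" using k nth_rotate[of 0 xs k] by (simp add: ys_def)
  moreover have "inj_on ((!) ys) {..<length ys}" using ys(2) by (auto simp: inj_on_def nth_eq_iff_index_eq)
  moreover have "G = map_graph ((!) ys) (std_cycle (length ys))"
  proof -
    have "cycle_edges ys = (`) ((!) ys) ` edges (std_cycle (length ys))"
      by (simp add: cycle_edges_def std_cycle_def setcompr_eq_image image_image)
    then have "edges G = (`) ((!) ys) ` edges (std_cycle (length ys))" using xs(4) ys(4) by simp
    moreover have "verts G = (!) ys ` {..<length ys}"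
      unfolding xs(3) ys(3)[symmetric] by (simp add: set_conv_nth setcompr_eq_image lessThan_def)
    ultimately show ?thesis by (cases G) (simp add: map_graph_def std_cycle_def)
  qed
  ultimately show thesis using that[of "length ys" "(!) ys"] xs(1) ys(1) by simp
qed

section \<open>Colourings of a path: the cycle opened at its root\<close>

definition colored_walks where
  "colored_walks m K x k b =
     {c \<in> {..k} \<rightarrow>\<^sub>E {..<m::nat}. c 0 = x \<and> c k = b \<and> (\<forall>i<k. \<not> K i (c i) (Suc i) (c (Suc i)))}"

lemma finite_colored_walks: "finite (colored_walks m K x k b)"
  unfolding colored_walks_def by (intro finite_Collect_conjI disjI1) (simp add: finite_PiE)

lemma card_UN_colored_walks:
  assumes "finite S"
  shows "card (\<Union>a\<in>S. colored_walks m K x k a) = (\<Sum>a\<in>S. card (colored_walks m K x k a))"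
proof -
  have "colored_walks m K x k a \<inter> colored_walks m K x k b = {}" if "a \<noteq> b" for a b
    using that by (auto simp: colored_walks_def)
  then show ?thesis using assms by (intro card_UN_disjoint) (auto simp: finite_colored_walks)
qed

lemma card_colored_walks_0:
  assumes "x < m"
  shows "card (colored_walks m K x 0 b) = (if b = x then 1 else 0)"
proof -
  have "colored_walks m K x 0 b = (if b = x then {\<lambda>i\<in>{0}. x} else {})"
    using assms by (auto simp: colored_walks_def fun_eq_iff PiE_iff extensional_def)
  then show ?thesis by simp
qed

lemma card_colored_walks_Suc:
  assumes "b < m"
  shows "card (colored_walks m K x (Suc k) b) =
    (\<Sum>a\<in>{a. a < m \<and> \<not> K k a (Suc k) b}. card (colored_walks m K x k a))"
proof -
  let ?S = "{a. a < m \<and> \<not> K k a (Suc k) b}"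
  have "bij_betw (\<lambda>c. restrict c {..k}) (colored_walks m K x (Suc k) b)
      (\<Union>a\<in>?S. colored_walks m K x k a)"
  proof (rule bij_betw_byWitness[where f' = "\<lambda>c. c(Suc k := b)"])
    show "\<forall>c\<in>colored_walks m K x (Suc k) b. (restrict c {..k})(Suc k := b) = c"
    proof
      fix c assume c: "c \<in> colored_walks m K x (Suc k) b"
      then have "c i = undefined" if "i \<notin> {..Suc k}" for i
        using that by (intro PiE_arb[of c]) (auto simp: colored_walks_def)
      then show "(restrict c {..k})(Suc k := b) = c"
        using c by (auto simp: fun_eq_iff colored_walks_def le_Suc_eq)
    qed
    show "\<forall>c\<in>\<Union>a\<in>?S. colored_walks m K x k a. restrict (c(Suc k := b)) {..k} = c"
    proof
      fix c assume "c \<in> (\<Union>a\<in>?S. colored_walks m K x k a)"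
      then have "c i = undefined" if "i \<notin> {..k}" for i
        using that by (intro PiE_arb[of c]) (auto simp: colored_walks_def)
      then show "restrict (c(Suc k := b)) {..k} = c" by (auto simp: fun_eq_iff)
    qed
    show "(\<lambda>c. restrict c {..k}) ` colored_walks m K x (Suc k) b
        \<subseteq> (\<Union>a\<in>?S. colored_walks m K x k a)"
    proof (intro image_subsetI)
      fix c assume c: "c \<in> colored_walks m K x (Suc k) b"
      then have "c k \<in> ?S" by (auto simp: colored_walks_def)
      moreover have "restrict c {..k} \<in> colored_walks m K x k (c k)"
        using c by (auto simp: colored_walks_def)
      ultimately show "restrict c {..k} \<in> (\<Union>a\<in>?S. colored_walks m K x k a)" by blast
    qed
    show "(\<lambda>c. c(Suc k := b)) ` (\<Union>a\<in>?S. colored_walks m K x k a)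
        \<subseteq> colored_walks m K x (Suc k) b"
    proof (intro image_subsetI)
      fix c assume "c \<in> (\<Union>a\<in>?S. colored_walks m K x k a)"
      then obtain a where a: "a < m" "\<not> K k a (Suc k) b" and c: "c \<in> colored_walks m K x k a" by blast
      have cE: "c \<in> {..k} \<rightarrow>\<^sub>E {..<m}" using c by (simp add: colored_walks_def)
      have "c(Suc k := b) \<in> {..Suc k} \<rightarrow>\<^sub>E {..<m}"
      proof (rule PiE_I)
        show "(c(Suc k := b)) i \<in> {..<m}" if "i \<in> {..Suc k}" for i
          using that cE assms by (auto simp: le_Suc_eq)
        show "(c(Suc k := b)) i = undefined" if "i \<notin> {..Suc k}" for i
          using that PiE_arb[OF cE, of i] by auto
      qed
      then show "c(Suc k := b) \<in> colored_walks m K x (Suc k) b"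
        using c a by (auto simp: colored_walks_def less_Suc_eq)
    qed
  qed
  then show ?thesis by (simp add: bij_betw_same_card card_UN_colored_walks)
qed

text \<open>Without the edge between \<open>n - 1\<close> and \<open>0\<close> the cycle is a path
  of length \<open>n - 1\<close> starting at the root; that edge restricts only the last colour
  \<open>b\<close>.\<close>

lemma rooted_colorings_std_cycle:
  assumes n: "3 \<le> n" and K: "conflict_relation (std_cycle n) m K" and x: "x < m"
  shows "rooted_colorings (std_cycle n) m K 0 x =
    (\<Union>b\<in>{b. b < m \<and> \<not> K (n - 1) b 0 x}. colored_walks m K x (n - 1) b)"
proof (intro equalityI subsetI)
  have V: "{..<n} = {..n - 1}" using n by auto
  {
    fix c assume c: "c \<in> rooted_colorings (std_cycle n) m K 0 x"
    then have nK: "\<not> K u (c u) v (c v)" if "{u, v} \<in> edges (std_cycle n)" for u v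
      using that by (simp add: rooted_colorings_def dp_colorings_def)
    have cE: "c \<in> {..n - 1} \<rightarrow>\<^sub>E {..<m}" and c0: "c 0 = x"
      using c by (simp_all add: rooted_colorings_def dp_colorings_def std_cycle_def V)
    have "c \<in> colored_walks m K x (n - 1) (c (n - 1))"
      using cE c0 nK[OF std_cycle_edgeI(1)[OF n]] by (auto simp: colored_walks_def)
    moreover have "c (n - 1) < m" using cE by auto
    ultimately show "c \<in> (\<Union>b\<in>{b. b < m \<and> \<not> K (n - 1) b 0 x}. colored_walks m K x (n - 1) b)"
      using nK[OF std_cycle_edgeI(2)[OF n]] c0 by blast
  }
  fix c assume "c \<in> (\<Union>b\<in>{b. b < m \<and> \<not> K (n - 1) b 0 x}. colored_walks m K x (n - 1) b)"
  then have cE: "c \<in> {..n - 1} \<rightarrow>\<^sub>E {..<m}" and c0: "c 0 = x" "\<not> K (n - 1) (c (n - 1)) 0 x"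
    and step: "\<And>i. i < n - 1 \<Longrightarrow> \<not> K i (c i) (Suc i) (c (Suc i))"
    by (auto simp: colored_walks_def)
  have lt: "c i < m" if "i < n" for i using cE that by auto
  \<comment> \<open>Walks record each edge in one orientation only; symmetry supplies the
    other.\<close>
  have sym: "K v (c v) u (c u)" if "{u, v} \<in> edges (std_cycle n)" "K u (c u) v (c v)" for u v
  proof -
    have "u < n" "v < n"
      using simple_graph_edgeD(1,2)[OF simple_graph_std_cycle[OF n] that(1)] by (simp_all add: std_cycle_def)
    then show ?thesis using K that lt unfolding conflict_relation_def by blast
  qed
  have "\<not> K u (c u) v (c v)" if e: "{u, v} \<in> edges (std_cycle n)" for u v
  proof
    assume k: "K u (c u) v (c v)"
    show False using e
    proof (rule std_cycle_edgeE[OF _ n])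
      fix i assume "Suc i < n" "{u, v} = {i, Suc i}"
      then show False using k sym[OF e k] step[of i] by (auto simp: doubleton_eq_iff)
    next
      assume "{u, v} = {n - 1, 0}"
      then show False using k sym[OF e k] c0 by (auto simp: doubleton_eq_iff)
    qed
  qed
  then show "c \<in> rooted_colorings (std_cycle n) m K 0 x"
    using cE c0 by (simp add: rooted_colorings_def dp_colorings_def std_cycle_def V)
qed

text \<open>The numbers of walks of length \<open>k\<close> in the complete graph on \<open>m\<close> vertices from a fixed vertex
  to itself and to another fixed vertex.\<close>

primrec walk_counts :: "nat \<Rightarrow> nat \<Rightarrow> nat \<times> nat" where
  "walk_counts m 0 = (1, 0)"
| "walk_counts m (Suc k) =
     ((m - 1) * snd (walk_counts m k), fst (walk_counts m k) + (m - 2) * snd (walk_counts m k))"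

text \<open>This is one step of the recursion of \<open>walk_counts\<close> as an inequality:
  \<open>B\<close> is the set of admissible preceding colours, and \<open>z\<close> is the marked
  colour with its own bound \<open>s\<close>.\<close>

lemma sum_marked_ge:
  fixes f :: "nat \<Rightarrow> nat"
  assumes B: "B \<subseteq> {..<m}" "m - 1 \<le> card B"
    and f: "s \<le> f z" "\<And>b. b < m \<Longrightarrow> b \<noteq> z \<Longrightarrow> d \<le> f b"
  shows "z \<notin> B \<Longrightarrow> (m - 1) * d \<le> sum f B" "z \<in> B \<Longrightarrow> s + (m - 2) * d \<le> sum f B"
proof -
  have fin: "finite B" using B(1) finite_subset by blast
  have ge: "card C * d \<le> sum f C" if "C \<subseteq> B" "z \<notin> C" for C
    using that B(1) f(2) by (intro sum_bounded_below[of C d f, simplified]) blast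
  show "(m - 1) * d \<le> sum f B" if "z \<notin> B"
    using that by (intro le_trans[OF mult_le_mono1[OF B(2)] ge]) simp_all
  show "s + (m - 2) * d \<le> sum f B" if z: "z \<in> B"
  proof -
    have "m - 2 \<le> card (B - {z})" using B(2) z fin by simp
    then have "(m - 2) * d \<le> sum f (B - {z})"
      by (intro le_trans[OF mult_le_mono1 ge]) auto
    then show ?thesis using f(1) sum.remove[OF fin z, of f] by simp
  qed
qed

lemma card_nonconflicting:
  assumes "\<And>a a'. a < m \<Longrightarrow> a' < m \<Longrightarrow> P a \<Longrightarrow> P a' \<Longrightarrow> a = a'"
  shows "m - 1 \<le> card {a. a < m \<and> \<not> P a}"
proof -
  have "card {a. a < m \<and> P a} \<le> 1" using assms by (simp add: card_le_Suc0_iff_eq)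
  moreover have "card {a. a < m \<and> \<not> P a} = card {..<m} - card {a. a < m \<and> P a}"
    by (subst card_Diff_subset[symmetric]) (auto intro!: arg_cong[of _ _ card])
  ultimately show ?thesis by simp
qed

text \<open>Missing edges of the cover only increase the counts, so the exact values for perfect matchings
  survive as lower bounds; \<open>z\<close> is the colour obtained by following the matchings from \<open>x\<close>, or any
  unmatched colour once the trail is interrupted.\<close>

lemma colored_walks_lower_bound:
  assumes x: "x < m"
    and inj1: "\<And>i a a' b. i < k \<Longrightarrow> a < m \<Longrightarrow> a' < m \<Longrightarrow> b < m \<Longrightarrow>
      K i a (Suc i) b \<Longrightarrow> K i a' (Suc i) b \<Longrightarrow> a = a'"
    and inj2: "\<And>i a b b'. i < k \<Longrightarrow> a < m \<Longrightarrow> b < m \<Longrightarrow> b' < m \<Longrightarrow>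
      K i a (Suc i) b \<Longrightarrow> K i a (Suc i) b' \<Longrightarrow> b = b'"
  shows "\<exists>z<m. fst (walk_counts m k) \<le> card (colored_walks m K x k z) \<and>
    (\<forall>b<m. b \<noteq> z \<longrightarrow> snd (walk_counts m k) \<le> card (colored_walks m K x k b))"
  using inj1 inj2
proof (induction k)
  case 0
  then show ?case using x by (intro exI[of _ x]) (simp add: card_colored_walks_0)
next
  case (Suc k)
  define s where "s = fst (walk_counts m k)"
  define d where "d = snd (walk_counts m k)"
  have "\<exists>z<m. fst (walk_counts m k) \<le> card (colored_walks m K x k z) \<and>
      (\<forall>b<m. b \<noteq> z \<longrightarrow> snd (walk_counts m k) \<le> card (colored_walks m K x k b))"
    using Suc.prems by (intro Suc.IH) (blast intro: less_SucI)+
  then obtain z where z: "z < m" "s \<le> card (colored_walks m K x k z)"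
    "\<And>b. b < m \<Longrightarrow> b \<noteq> z \<Longrightarrow> d \<le> card (colored_walks m K x k b)"
    by (auto simp: s_def d_def)
  define B where "B b = {a. a < m \<and> \<not> K k a (Suc k) b}" for b
  have B: "B b \<subseteq> {..<m}" for b by (auto simp: B_def)
  have cB: "m - 1 \<le> card (B b)" if "b < m" for b
    unfolding B_def using Suc.prems(1)[of k] that by (intro card_nonconflicting) blast
  have f: "card (colored_walks m K x (Suc k) b) = (\<Sum>a\<in>B b. card (colored_walks m K x k a))"
    if "b < m" for b using card_colored_walks_Suc[OF that] by (simp add: B_def)
  have ge1: "(m - 1) * d \<le> card (colored_walks m K x (Suc k) b)" if "b < m" "z \<notin> B b" for b
    unfolding f[OF that(1)] by (rule sum_marked_ge(1)[where z = z and f = "\<lambda>a. card (colored_walks m K x k a)", OF B cB[OF that(1)] z(2) z(3) that(2)])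
  have ge2: "s + (m - 2) * d \<le> card (colored_walks m K x (Suc k) b)" if "b < m" "z \<in> B b" for b
    unfolding f[OF that(1)] by (rule sum_marked_ge(2)[where z = z and f = "\<lambda>a. card (colored_walks m K x k a)", OF B cB[OF that(1)] z(2) z(3) that(2)])
  have wc: "fst (walk_counts m (Suc k)) = (m - 1) * d" "snd (walk_counts m (Suc k)) = s + (m - 2) * d"
    by (simp_all add: s_def d_def)
  show ?case
  proof (cases "\<exists>z'<m. z \<notin> B z'")
    case True
    \<comment> \<open>The marked colour \<open>z\<close> is matched to \<open>z'\<close>, which
      becomes the new mark; no other colour excludes \<open>z\<close>.\<close>
    then obtain z' where z': "z' < m" "z \<notin> B z'" by blast
    have "z \<in> B b" if "b < m" "b \<noteq> z'" for b
      using Suc.prems(2)[of k z b z'] z' that z(1) by (auto simp: B_def)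
    then show ?thesis unfolding wc using z' ge1 ge2 by blast
  next
    case False
    have "\<exists>z'<m. B z' = {..<m}"
    proof (rule ccontr)
      assume "\<not> (\<exists>z'<m. B z' = {..<m})"
      then have "\<exists>a. a < m \<and> K k a (Suc k) b" if "b < m" for b using that by (auto simp: B_def)
      then obtain g where g: "\<And>b. b < m \<Longrightarrow> g b < m \<and> K k (g b) (Suc k) b" by metis
      \<comment> \<open>If every new colour had a partner, the partners would be \<open>m\<close>
        distinct colours other than the unmatched \<open>z\<close>, which is impossible. Hence some
        \<open>z'\<close> is unmatched.\<close>
      have "inj_on g {..<m}"
      proof (rule inj_onI)
        fix b b' assume "b \<in> {..<m}" "b' \<in> {..<m}" "g b = g b'"
        then show "b = b'" using Suc.prems(2)[of k "g b" b b'] g[of b] g[of b'] by simp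
      qed
      moreover have "g ` {..<m} \<subseteq> {..<m} - {z}"
      proof
        fix y assume "y \<in> g ` {..<m}"
        then obtain b where b: "b < m" "y = g b" by auto
        then show "y \<in> {..<m} - {z}" using g[of b] False by (auto simp: B_def)
      qed
      ultimately have "card {..<m} \<le> card ({..<m} - {z})" by (intro card_inj_on_le) auto
      then show False using z(1) by simp
    qed
    then obtain z' where z': "z' < m" "B z' = {..<m}" by blast
    \<comment> \<open>All preceding colours are admissible for \<open>z'\<close>; the
      \<open>m - 1\<close> of them other than \<open>z\<close> already give the bound.\<close>
    have "card ({..<m} - {z}) * d \<le> (\<Sum>a\<in>{..<m} - {z}. card (colored_walks m K x k a))"
      using z(3) by (intro sum_bounded_below[of _ d, simplified]) auto
    also have "\<dots> \<le> (\<Sum>a\<in>{..<m}. card (colored_walks m K x k a))" by (intro sum_mono2) auto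
    finally have "(m - 1) * d \<le> card (colored_walks m K x (Suc k) z')"
      using z(1) by (simp add: f[OF z'(1)] z'(2))
    then show ?thesis unfolding wc using z' ge2 False by blast
  qed
qed

section \<open>Exact counts in twisted covers of the cycle\<close>

lemma sum_two_valued:
  fixes s d :: nat
  assumes "b < m" "x < m"
  shows "(\<Sum>a\<in>{a. a < m \<and> a \<noteq> b}. if a = x then s else d) =
    (if b = x then (m - 1) * d else s + (m - 2) * d)"
proof -
  have eq: "{a. a < m \<and> a \<noteq> b} = {..<m} - {b}" by auto
  show ?thesis
  proof (cases "b = x")
    case True
    have "(\<Sum>a\<in>{..<m} - {b}. if a = x then s else d) = (\<Sum>a\<in>{..<m} - {b}. d)"
      using True by (intro sum.cong) auto
    also have "\<dots> = (m - 1) * d" using assms by simp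
    finally show ?thesis unfolding eq using True by simp
  next
    case False
    then have "(\<Sum>a\<in>{..<m} - {b}. if a = x then s else d) =
        s + (\<Sum>a\<in>{..<m} - {b} - {x}. if a = x then s else d)"
      using assms by (subst sum.remove[of _ x]) auto
    also have "(\<Sum>a\<in>{..<m} - {b} - {x}. if a = x then s else d) = (\<Sum>a\<in>{..<m} - {b} - {x}. d)"
      by (intro sum.cong) auto
    \<comment> \<open>Two distinct colours below \<open>m\<close> give \<open>m \<ge> 2\<close>, so
      the subtraction is not truncated.\<close>
    also have "\<dots> = (m - 2) * d" using False assms by (simp add: numeral_2_eq_2)
    finally show ?thesis unfolding eq using False by simp
  qed
qed

text \<open>When all matchings are the identity, compatible colourings of the path are walks in the
  complete graph on the colours.\<close>

lemma card_colored_walks_untwisted: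
  assumes "x < m" "b < m"
    and "\<And>i a b. i < k \<Longrightarrow> a < m \<Longrightarrow> b < m \<Longrightarrow> K i a (Suc i) b \<longleftrightarrow> a = b"
  shows "card (colored_walks m K x k b) = (if b = x then fst (walk_counts m k) else snd (walk_counts m k))"
  using assms(2,3)
proof (induction k arbitrary: b)
  case 0
  then show ?case using assms(1) by (simp add: card_colored_walks_0)
next
  case (Suc k)
  have "{a. a < m \<and> \<not> K k a (Suc k) b} = {a. a < m \<and> a \<noteq> b}"
    using Suc.prems by auto
  then have "card (colored_walks m K x (Suc k) b) =
      (\<Sum>a\<in>{a. a < m \<and> a \<noteq> b}. card (colored_walks m K x k a))"
    using card_colored_walks_Suc[OF Suc.prems(1)] by simp
  also have "\<dots> = (\<Sum>a\<in>{a. a < m \<and> a \<noteq> b}.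
      if a = x then fst (walk_counts m k) else snd (walk_counts m k))"
    using Suc by (intro sum.cong) auto
  finally show ?case using sum_two_valued[OF Suc.prems(1) assms(1)] by simp
qed

text \<open>Colours are matched identically along the cycle except on the edge \<open>{0, n - 1}\<close>, where \<open>\<tau>\<close> is the
  monodromy of the cover.\<close>

definition twist :: "nat \<Rightarrow> (nat \<Rightarrow> nat) \<Rightarrow> nat \<Rightarrow> nat \<Rightarrow> nat \<Rightarrow> nat \<Rightarrow> bool" where
  "twist n \<tau> u i v j =
     (if {u, v} = {0, n - 1} then (if u = 0 then j = \<tau> i else i = \<tau> j) else i = j)"

text \<open>On the twisted edge, partners of colours at \<open>0\<close> are unique because
  \<open>\<tau>\<close> is a function, and partners of colours at \<open>n - 1\<close> because it is
  injective.\<close>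

lemma conflict_relation_twist:
  assumes "3 \<le> n" "inj_on \<tau> {..<m}"
  shows "conflict_relation (std_cycle n) m (twist n \<tau>)"
  unfolding conflict_relation_def
proof (intro allI impI, elim conjE, intro conjI allI impI)
  fix u v i j assume a: "{u, v} \<in> edges (std_cycle n)" "i < m" "j < m" "twist n \<tau> u i v j"
  have "u \<noteq> v" using simple_graph_edgeD(3)[OF simple_graph_std_cycle[OF assms(1)] a(1)] .
  then show "twist n \<tau> v j u i" using a(4) by (auto simp: twist_def doubleton_eq_iff split: if_splits)
  fix j' assume "j' < m" "twist n \<tau> u i v j'"
  then show "j' = j" using a assms(2) by (auto simp: twist_def inj_on_def split: if_splits)
qed

text \<open>The closing edge forbids the colour \<open>\<tau> x\<close> at \<open>n - 1\<close> and
  acts as a last step to \<open>\<tau> x\<close>, so the rooted count is the number of walks of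
  length \<open>n\<close> from \<open>x\<close> to \<open>\<tau> x\<close>. The assumption on
  \<open>N\<close> holds if \<open>\<tau>\<close> fixes every colour or none.\<close>

lemma P_DP_std_cycle_le:
  assumes n: "3 \<le> n" and \<tau>: "inj_on \<tau> {..<m}" "\<And>x. x < m \<Longrightarrow> \<tau> x < m"
    and N: "\<And>x. x < m \<Longrightarrow> (if \<tau> x = x then fst (walk_counts m n) else snd (walk_counts m n)) = N"
    and m: "1 \<le> m"
  shows "P_DP (std_cycle n) m \<le> m * N"
proof -
  let ?K = "twist n \<tau>"
  note K = conflict_relation_twist[OF n \<tau>(1)]
  have sG: "simple_graph (std_cycle n)" using n by (rule simple_graph_std_cycle)
  have "card (rooted_colorings (std_cycle n) m ?K 0 x) = N" if x: "x < m" for x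
  proof -
    \<comment> \<open>For \<open>n \<ge> 3\<close> no edge of the opened path is the closing edge,
      so its matchings are untwisted.\<close>
    have "\<not> {i, Suc i} = {0, n - 1}" if "i < n - 1" for i
      using n that by (auto simp: doubleton_eq_iff)
    then have flat: "?K i a (Suc i) b \<longleftrightarrow> a = b" if "i < n - 1" for i a b
      using that by (simp add: twist_def)
    have "{b. b < m \<and> \<not> ?K (n - 1) b 0 x} = {b. b < m \<and> b \<noteq> \<tau> x}"
      using n by (auto simp: twist_def insert_commute)
    then have "card (rooted_colorings (std_cycle n) m ?K 0 x) =
        (\<Sum>b\<in>{b. b < m \<and> b \<noteq> \<tau> x}. card (colored_walks m ?K x (n - 1) b))"
      by (simp add: rooted_colorings_std_cycle[OF n K x] card_UN_colored_walks)
    also have "\<dots> = (\<Sum>b\<in>{b. b < m \<and> b \<noteq> \<tau> x}.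
        if b = x then fst (walk_counts m (n - 1)) else snd (walk_counts m (n - 1)))"
      using flat x by (intro sum.cong card_colored_walks_untwisted) auto
    also have "\<dots> = (if \<tau> x = x then fst (walk_counts m (Suc (n - 1))) else snd (walk_counts m (Suc (n - 1))))"
      using sum_two_valued[OF \<tau>(2)[OF x] x] by simp
    also have "Suc (n - 1) = n" using n by simp
    also note N[OF x]
    finally show ?thesis .
  qed
  then have "card (dp_colorings (std_cycle n) m ?K) = m * N"
    using card_dp_colorings_eq_sum[OF sG, of 0 m ?K] n by (simp add: std_cycle_def)
  then show ?thesis using P_DP_le_conflict[OF sG m K] by simp
qed

text \<open>Each of the two walk counts, multiplied by \<open>m\<close>, bounds
  \<open>P_DP (std_cycle n) m\<close> from above, and every rooted count is at least one of the
  two.\<close>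

lemma std_cycle_balanced_at:
  assumes n: "3 \<le> n" and m: "1 \<le> m"
  shows "balanced_at (std_cycle n) m 0"
  unfolding balanced_at_def
proof (intro allI impI, elim conjE)
  fix K x assume K: "conflict_relation (std_cycle n) m K" and x: "x < m"
  have up1: "P_DP (std_cycle n) m \<le> m * fst (walk_counts m n)"
    using n m by (intro P_DP_std_cycle_le[of n "\<lambda>x. x"]) auto
  have up2: "P_DP (std_cycle n) m \<le> m * snd (walk_counts m n)"
  proof (cases "m = 1")
    case True
    \<comment> \<open>A single colour admits no fixed-point-free permutation; here the untwisted
      cover already shows that the minimum is 0.\<close>
    have "fst (walk_counts m n) = 0" using n True by (cases n) auto
    then show ?thesis using up1 by simp
  next
    case False
    then have m2: "2 \<le> m" using m by simp
    \<comment> \<open>The cyclic shift moves every colour once \<open>m \<ge> 2\<close>.\<close>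
    have "Suc x mod m \<noteq> x" if "x < m" for x using that m2 by (cases "Suc x = m") auto
    moreover have "inj_on (\<lambda>x. Suc x mod m) {..<m}"
    proof (rule inj_onI)
      fix x y assume "x \<in> {..<m}" "y \<in> {..<m}" "Suc x mod m = Suc y mod m"
      then show "x = y" by (cases "Suc x = m"; cases "Suc y = m") auto
    qed
    ultimately show ?thesis using n m by (intro P_DP_std_cycle_le[of n "\<lambda>x. Suc x mod m"]) auto
  qed
  have inj2: "b = b'" if "{u, v} \<in> edges (std_cycle n)" "a < m" "b < m" "b' < m" "K u a v b" "K u a v b'"
    for u v a b b' using K that unfolding conflict_relation_def by blast
  have sym: "K v b u a" if "{u, v} \<in> edges (std_cycle n)" "a < m" "b < m" "K u a v b" for u v a b
    using K that unfolding conflict_relation_def by blast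
  have inj1: "a = a'" if e: "{u, v} \<in> edges (std_cycle n)"
    and h: "a < m" "a' < m" "b < m" "K u a v b" "K u a' v b" for u v a a' b
  proof -
    have "{v, u} \<in> edges (std_cycle n)" using e by (simp add: insert_commute)
    from inj2[OF this h(3,1,2) sym[OF e h(1,3,4)] sym[OF e h(2,3,5)]] show ?thesis .
  qed
  have "\<exists>z<m. fst (walk_counts m (n - 1)) \<le> card (colored_walks m K x (n - 1) z) \<and>
    (\<forall>b<m. b \<noteq> z \<longrightarrow> snd (walk_counts m (n - 1)) \<le> card (colored_walks m K x (n - 1) b))"
  proof (rule colored_walks_lower_bound[OF x])
    fix i a a' b assume "i < n - 1"
    then have e: "{i, Suc i} \<in> edges (std_cycle n)" using n by (intro std_cycle_edgeI(1)) auto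
    show "a = a'" if "a < m" "a' < m" "b < m" "K i a (Suc i) b" "K i a' (Suc i) b"
      using inj1[OF e that] .
    show "a' = b" if "a < m" "a' < m" "b < m" "K i a (Suc i) a'" "K i a (Suc i) b"
      using inj2[OF e that] .
  qed
  then obtain z where z: "fst (walk_counts m (n - 1)) \<le> card (colored_walks m K x (n - 1) z)"
    "\<And>b. b < m \<Longrightarrow> b \<noteq> z \<Longrightarrow> snd (walk_counts m (n - 1)) \<le> card (colored_walks m K x (n - 1) b)"
    by blast
  let ?B = "{b. b < m \<and> \<not> K (n - 1) b 0 x}"
  have N: "card (rooted_colorings (std_cycle n) m K 0 x) = (\<Sum>b\<in>?B. card (colored_walks m K x (n - 1) b))"
    by (simp add: rooted_colorings_std_cycle[OF n K x] card_UN_colored_walks)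
  have sub: "?B \<subseteq> {..<m}" by auto
  have cB: "m - 1 \<le> card ?B"
    using inj1[OF std_cycle_edgeI(2)[OF n]] x by (intro card_nonconflicting) blast
  have wc: "walk_counts m n = walk_counts m (Suc (n - 1))" using n by simp
  \<comment> \<open>The first alternative arises if the closing edge forbids \<open>z\<close>, the
    second if it allows \<open>z\<close>.\<close>
  have "fst (walk_counts m n) \<le> card (rooted_colorings (std_cycle n) m K 0 x) \<or>
      snd (walk_counts m n) \<le> card (rooted_colorings (std_cycle n) m K 0 x)"
    using sum_marked_ge[OF sub cB, where f = "\<lambda>b. card (colored_walks m K x (n - 1) b)" and z = z] z
    unfolding N wc walk_counts.simps fst_conv snd_conv by blast
  then show "P_DP (std_cycle n) m \<le> m * card (rooted_colorings (std_cycle n) m K 0 x)"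
    using up1 up2 by (meson le_trans mult_le_mono2)
qed

lemma cycle_balanced_at:
  assumes "cycle_graph G" "v \<in> verts G" "1 \<le> m"
  shows "balanced_at G m v"
proof -
  obtain n f where nf: "3 \<le> n" "inj_on f {..<n}" "G = map_graph f (std_cycle n)" "f 0 = v"
    using cycle_graph_std_cycle[OF assms(1,2)] .
  have "balanced_at (map_graph f (std_cycle n)) m (f 0)"
    using nf(1,2) assms(3)
    by (intro balanced_at_map_graph simple_graph_std_cycle std_cycle_balanced_at)
      (auto simp: std_cycle_def)
  then show ?thesis by (simp add: nf(3,4))
qed

section \<open>The product formula for vertex-gluings\<close>

theorem theorem1p12:
  fixes n m :: nat
    and Gs :: "nat \<Rightarrow> 'a ugraph"
    and G :: "'b ugraph"
  assumes "2 \<le> n"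
    and "\<forall>i\<in>{1..n}. simple_graph (Gs i)"
    and "disjoint_family_on (\<lambda>i. verts (Gs i)) {1..n}"
    and "\<forall>i\<in>{1..n}. chordal (Gs i) \<or> cycle_graph (Gs i)"
    and "vertex_gluing {1..n} Gs G"
    and "1 \<le> m"
  shows "real (P_DP G m) = (\<Prod>i=1..n. real (P_DP (Gs i) m)) / real m ^ (n - 1)"
proof -
  obtain u f where u: "\<And>i. i \<in> {1..n} \<Longrightarrow> u i \<in> verts (Gs i)"
    and f: "\<forall>x\<in>verts (disjoint_union {1..n} Gs). \<forall>y\<in>verts (disjoint_union {1..n} Gs).
      f x = f y \<longleftrightarrow> x = y \<or> (x \<in> u ` {1..n} \<and> y \<in> u ` {1..n})"
    and G: "G = map_graph f (disjoint_union {1..n} Gs)"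
    using assms(5) unfolding vertex_gluing_def by blast
  have f': "f x = f y \<longleftrightarrow> x = y \<or> (x \<in> u ` {1..n} \<and> y \<in> u ` {1..n})"
    if "x \<in> verts (Gs i)" "y \<in> verts (Gs j)" "i \<in> {1..n}" "j \<in> {1..n}" for x y i j
  proof -
    have "x \<in> verts (disjoint_union {1..n} Gs)" "y \<in> verts (disjoint_union {1..n} Gs)"
      using that unfolding disjoint_union_def by auto
    then show ?thesis using f by blast
  qed
  have disj: "i = j" if "x \<in> verts (Gs i)" "x \<in> verts (Gs j)" "i \<in> {1..n}" "j \<in> {1..n}" for x i j
    using assms(3) that unfolding disjoint_family_on_def by blast
  \<comment> \<open>Disjointness makes \<open>u i\<close> the only root in \<open>Gs i\<close>;
    hence \<open>f\<close> identifies no two vertices of the same part.\<close>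
  have root: "x = u i" if "x \<in> u ` {1..n}" "x \<in> verts (Gs i)" "i \<in> {1..n}" for x i
    using that u disj by blast
  have inj: "inj_on f (verts (Gs i))" if "i \<in> {1..n}" for i
    using f' root that by (intro inj_onI) metis
  have one: "1 \<in> {1..n}" using assms(1) by simp
  define w where "w = f (u 1)"
  have fu: "f (u i) = w" if "i \<in> {1..n}" for i
    using f'[OF u u] that one unfolding w_def by blast
  \<comment> \<open>The images of the parts overlap only in the glued vertex \<open>w\<close>, and
    \<open>G\<close> is their union.\<close>
  let ?G = "\<lambda>i. map_graph f (Gs i)"
  have "balanced_at (?G i) m w" if i: "i \<in> {1..n}" for i
  proof -
    have "balanced_at (Gs i) m (u i)"
      using chordal_balanced_at[OF _ _ u[OF i] assms(6)] cycle_balanced_at[OF _ u[OF i] assms(6)]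
        bspec[OF assms(2) i] bspec[OF assms(4) i] by blast
    from balanced_at_map_graph[OF bspec[OF assms(2) i] inj[OF i] assms(6) u[OF i] this]
    show ?thesis unfolding fu[OF i] .
  qed
  moreover have "verts (?G i) \<inter> verts (?G j) \<subseteq> {w}" if ij: "i \<in> {1..n}" "j \<in> {1..n}" "i \<noteq> j" for i j
  proof
    fix b assume "b \<in> verts (?G i) \<inter> verts (?G j)"
    then have "b \<in> f ` verts (Gs i)" "b \<in> f ` verts (Gs j)" by (simp_all add: map_graph_def)
    then obtain x y where xy: "b = f x" "b = f y" "x \<in> verts (Gs i)" "y \<in> verts (Gs j)"
      by (metis imageE)
    \<comment> \<open>The parts are disjoint, so \<open>x\<close> and \<open>y\<close> differ, and
      \<open>f\<close> identifies different vertices only if both are roots.\<close>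
    then have "x \<in> u ` {1..n}" using f'[OF xy(3,4) ij(1,2)] disj ij by metis
    then show "b \<in> {w}" using root[OF _ xy(3) ij(1)] fu[OF ij(1)] xy(1) by simp
  qed
  moreover have "w \<in> verts (?G i)" if "i \<in> {1..n}" for i
    using fu[OF that] u[OF that] by (auto simp: map_graph_def)
  moreover have "simple_graph (?G i)" if "i \<in> {1..n}" for i
    using bspec[OF assms(2) that] inj[OF that] by (rule simple_graph_map_graph)
  ultimately have "m ^ (n - 1) * P_DP (disjoint_union {1..n} ?G) m = (\<Prod>i=1..n. P_DP (?G i) m)"
    using P_DP_amalgam[of n m ?G w] assms(1,6) by simp
  also have "\<dots> = (\<Prod>i=1..n. P_DP (Gs i) m)"
    using P_DP_map_graph[OF bspec[OF assms(2)] inj assms(6)] by (intro prod.cong) simp_all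
  finally have "m ^ (n - 1) * P_DP G m = (\<Prod>i=1..n. P_DP (Gs i) m)"
    by (simp add: G map_graph_disjoint_union)
  then have "real m ^ (n - 1) * real (P_DP G m) = (\<Prod>i=1..n. real (P_DP (Gs i) m))"
    by (metis of_nat_mult of_nat_power of_nat_prod)
  then show ?thesis using assms(6) by (simp add: field_simps)
qed

end
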